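(* Let $X\subseteq\mathbb{R}^n$ be a convex compact set with diameter $D_X$, and let $f:X\to\mathbb{R}$ be convex with $\|f'(x)-f'(y)\|_*\le L\|x-y\|$ for all $x,y\in X$, for some $L>0$. If the parameters of the CALGD algorithm (see context) are $$\beta_k=\frac{3L}{k+1},\quad\gamma_k=\frac{3}{k+2},\quad\eta_k=\frac{LD_X^2}{k(k+1)},\quad\forall k\ge1,$$ and $\|f'(x^* )\|$ is bounded for any minimizer $x^*$ of $f$ over $X$, then for any $k\ge1$, $$f(y_k)-f(x^* )\le\frac{15LD_X^2}{2(k+1)(k+2)}.$$ As a consequence, the total number of calls to the FO oracle and to the LOsep oracle performed by CALGD for finding an $\epsilon$-solution of $\min_{x\in X}f(x)$ can be bounded by $\mathcal{O}\left(\sqrt{LD_X^2/\epsilon}\right)$ and $\mathcal{O}\left(LD_X^2/\epsilon\right)$, respectively.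
   Context: $\|\cdot\|$ is the norm associated with the inner product of $\mathbb{R}^n$, $\|\cdot\|_*$ its conjugate norm, $D_X=\max_{x,y\in X}\|x-y\|$. An $\epsilon$-solution is $\bar x\in X$ with $f(\bar x)-f(x^* )\le\epsilon$. CALGD is run for the number of outer iterations for which the displayed convergence bound guarantees accuracy $\epsilon$. $\mathcal{O}(\cdot)$ hides a constant factor depending only on $\alpha$; the bound is for all sufficiently small $\epsilon>0$ (the threshold may depend on the other data). CALGD algorithm (exact gradients $f'$ from a first-order (FO) oracle). Input: $x_0\in X$, iteration limit $N$, $\alpha\ge1$, parameters $\beta_k>0,\gamma_k\in[0,1],\eta_k\ge0$. Set $y_0=x_0$. For $k=1,\dots,N$: $z_k=(1-\gamma_k)y_{k-1}+\gamma_kx_{k-1}$; $x_k=\mathrm{LCG}(f'(z_k),\beta_k,x_{k-1},\alpha,\eta_k)$; $y_k=(1-\gamma_k)y_{k-1}+\gamma_kx_k$. Output $y_N$. Here $\mathrm{LCG}(g,\beta,x,\alpha,\eta)$ is the output of the LCG procedure below applied to $\phi(u)=\langle g,u\rangle+\frac\beta2\|u-x\|^2$ from $u_1=x$; thus $x_k$ satisfies $\langle f'(z_k)+\beta_k(x_k-x_{k-1}),x_k-u\rangle\le\eta_k$ for all $u\in X$. Weak separation oracle $\mathrm{LOsep}_X(c,x,\Phi,\alpha)$: given $c\in\mathbb{R}^n$, $x\in X$, $\Phi>0$, $\alpha\ge1$, it returns a vertex (extreme point) $y\in X$ such that either (1) $c^T(x-y)>\Phi/\alpha$, or (2) $y\in\operatorname{argmax}_{z\in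 X}c^T(x-z)$ and $c^T(x-y)\le\Phi$. LCG procedure. Input: smooth convex $\phi$, $u_1\in X$, $\alpha\ge1$, $\eta$. Set $\Phi_0\leftarrow\max_{u\in X}\nabla\phi(u_1)^T(u_1-u)$. For $t=1,2,\dots$: let $v_t\leftarrow\mathrm{LOsep}_X(\nabla\phi(u_t),u_t,\Phi_{t-1},\alpha)$. If it is not the case that $\nabla\phi(u_t)^T(u_t-v_t)>\Phi_{t-1}/\alpha$, then: if $\Phi_{t-1}=\eta$, stop and return $u_t$; otherwise $\Phi_t\leftarrow\max\{\Phi_{t-1}/2,\eta\}$. (Otherwise $\Phi_t\leftarrow\Phi_{t-1}$.) Then choose $\lambda_t\in\operatorname{argmin}_{\lambda\in[0,1]}\phi((1-\lambda)u_t+\lambda v_t)$ and set $u_{t+1}\leftarrow(1-\lambda_t)u_t+\lambda_tv_t$.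
   Formalization: The oracle-call bounds assume D_X > 0. The LOsep bound fails for the stated Φ_0 when α > 1; it is proved with Φ_0 replaced by max{Φ_0, η}, and for the stated Φ_0 only if α = 1 or Φ_0 ≥ η_k in every LCG call. *)

theory Defs
  imports "HOL-Analysis.Analysis"
begin

section \<open>All Euclidean spaces inside one type\<close>

text \<open>
  The constants hidden in the complexity bounds must not depend on the dimension, so the
  dimension has to be quantified inside the statement.  Therefore every R^n is realised as a
  subspace of a single inner product space: the finitely supported real sequences with the
  standard inner product.
\<close>

typedef fseq = "{x :: nat \<Rightarrow> real. finite {i. x i \<noteq> 0}}"
  morphisms coord Abs_fseq
  by (rule exI[of _ "\<lambda>_. 0"]) simp

setup_lifting type_definition_fseq

lemma finite_supp: "finite {i. coord x i \<noteq> 0}"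
  using coord[of x] by simp

instantiation fseq :: real_vector
begin

lift_definition zero_fseq :: fseq is "\<lambda>_. 0"
  by simp

lift_definition plus_fseq :: "fseq \<Rightarrow> fseq \<Rightarrow> fseq" is "\<lambda>x y i. x i + y i"
proof -
  fix x y :: "nat \<Rightarrow> real"
  assume "finite {i. x i \<noteq> 0}" "finite {i. y i \<noteq> 0}"
  then show "finite {i. x i + y i \<noteq> 0}"
    by (rule finite_subset[rotated, OF finite_UnI]) auto
qed

lift_definition minus_fseq :: "fseq \<Rightarrow> fseq \<Rightarrow> fseq" is "\<lambda>x y i. x i - y i"
proof -
  fix x y :: "nat \<Rightarrow> real"
  assume "finite {i. x i \<noteq> 0}" "finite {i. y i \<noteq> 0}"
  then show "finite {i. x i - y i \<noteq> 0}"
    by (rule finite_subset[rotated, OF finite_UnI]) auto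
qed

lift_definition uminus_fseq :: "fseq \<Rightarrow> fseq" is "\<lambda>x i. - x i"
  by simp

lift_definition scaleR_fseq :: "real \<Rightarrow> fseq \<Rightarrow> fseq" is "\<lambda>c x i. c * x i"
  by (erule finite_subset[rotated]) auto

instance
  by standard (transfer; simp add: algebra_simps fun_eq_iff)+

end

instantiation fseq :: real_inner
begin

definition inner_fseq :: "fseq \<Rightarrow> fseq \<Rightarrow> real" where
  "inner_fseq x y = (\<Sum>i | coord x i \<noteq> 0. coord x i * coord y i)"

definition norm_fseq :: "fseq \<Rightarrow> real" where
  "norm_fseq x = sqrt (inner x x)"

definition sgn_fseq :: "fseq \<Rightarrow> fseq" where
  "sgn_fseq x = x /\<^sub>R norm x"

definition dist_fseq :: "fseq \<Rightarrow> fseq \<Rightarrow> real" where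
  "dist_fseq x y = norm (x - y)"

definition uniformity_fseq :: "(fseq \<times> fseq) filter" where
  "uniformity_fseq = (INF e\<in>{0 <..}. principal {(x, y). dist x y < e})"

definition open_fseq :: "fseq set \<Rightarrow> bool" where
  "open_fseq U = (\<forall>x\<in>U. eventually (\<lambda>(x', y). x' = x \<longrightarrow> y \<in> U) uniformity)"

lemma inner_fseq_superset:
  assumes "finite A" "{i. coord x i \<noteq> 0} \<subseteq> A"
  shows "inner x y = (\<Sum>i\<in>A. coord x i * coord y i)"
  unfolding inner_fseq_def using assms by (intro sum.mono_neutral_left) auto

instance
proof
  fix x y z :: fseq and r :: real
  let ?A = "{i. coord x i \<noteq> 0} \<union> {i. coord y i \<noteq> 0}"
  have fin: "finite ?A"
    using finite_supp by simp
  have x: "inner x w = (\<Sum>i\<in>?A. coord x i * coord w i)" for w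
    by (intro inner_fseq_superset fin) auto
  have y: "inner y w = (\<Sum>i\<in>?A. coord y i * coord w i)" for w
    by (intro inner_fseq_superset fin) auto
  show "inner x y = inner y x"
    unfolding x y by (simp add: mult.commute)
  have "inner (x + y) z = (\<Sum>i\<in>?A. coord (x + y) i * coord z i)"
    by (intro inner_fseq_superset fin) (auto simp: plus_fseq.rep_eq)
  then show "inner (x + y) z = inner x z + inner y z"
    unfolding x y by (simp add: plus_fseq.rep_eq sum.distrib algebra_simps)
  have "inner (r *\<^sub>R x) y = (\<Sum>i\<in>?A. coord (r *\<^sub>R x) i * coord y i)"
    by (intro inner_fseq_superset fin) (auto simp: scaleR_fseq.rep_eq)
  then show "inner (r *\<^sub>R x) y = r * inner x y"
    unfolding x by (simp add: scaleR_fseq.rep_eq sum_distrib_left algebra_simps)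
  show "0 \<le> inner x x"
    unfolding inner_fseq_def by (intro sum_nonneg) simp
  have "inner x x = 0 \<longleftrightarrow> (\<forall>i. coord x i = 0)"
    unfolding inner_fseq_def using finite_supp[of x]
    by (subst sum_nonneg_eq_0_iff) auto
  also have "\<dots> \<longleftrightarrow> x = 0"
    by transfer auto
  finally show "inner x x = 0 \<longleftrightarrow> x = 0" .
qed (fact norm_fseq_def sgn_fseq_def dist_fseq_def uniformity_fseq_def open_fseq_def)+

end

definition Rspace :: "nat \<Rightarrow> fseq set" where
  "Rspace n = {x. \<forall>i\<ge>n. coord x i = 0}"

lemma inner_Rspace:
  assumes "x \<in> Rspace n"
  shows "inner x y = (\<Sum>i<n. coord x i * coord y i)"
  using assms by (intro inner_fseq_superset) (auto simp: Rspace_def not_le[symmetric])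


section \<open>Problem class\<close>

definition conj_norm :: "'a::real_inner set \<Rightarrow> 'a \<Rightarrow> real" where
  "conj_norm V \<xi> = (SUP w\<in>{w \<in> V. norm w \<le> 1}. inner \<xi> w)"

text \<open>
  The function lives on \<^term>\<open>X\<close> only, so its gradient is taken relative to \<^term>\<open>X\<close>.  If
  \<^term>\<open>X\<close> has empty interior this does not determine \<^term>\<open>f'\<close>; then \<^term>\<open>f'\<close> is any
  selection of such gradients (the one answered by the first-order oracle).
\<close>

definition smooth_convex_problem ::
  "nat \<Rightarrow> fseq set \<Rightarrow> (fseq \<Rightarrow> real) \<Rightarrow> (fseq \<Rightarrow> fseq) \<Rightarrow> real \<Rightarrow> bool" where
  "smooth_convex_problem n X f f' L \<longleftrightarrow>
     X \<subseteq> Rspace n \<and> convex X \<and> compact X \<and>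
     convex_on X f \<and>
     (\<forall>x\<in>X. f' x \<in> Rspace n) \<and>
     (\<forall>x\<in>X. (f has_derivative (\<lambda>h. inner (f' x) h)) (at x within X)) \<and>
     L > 0 \<and>
     (\<forall>x\<in>X. \<forall>y\<in>X. conj_norm (Rspace n) (f' x - f' y) \<le> L * norm (x - y))"

definition minimizer :: "'a set \<Rightarrow> ('a \<Rightarrow> real) \<Rightarrow> 'a \<Rightarrow> bool" where
  "minimizer X f xs \<longleftrightarrow> is_arg_min f (\<lambda>x. x \<in> X) xs"

definition eps_solution :: "'a set \<Rightarrow> ('a \<Rightarrow> real) \<Rightarrow> real \<Rightarrow> 'a \<Rightarrow> bool" where
  "eps_solution X f \<epsilon> xb \<longleftrightarrow> xb \<in> X \<and> (\<forall>xs. minimizer X f xs \<longrightarrow> f xb - f xs \<le> \<epsilon>)"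


section \<open>Weak separation oracle and LCG procedure\<close>

text \<open>
  \<^term>\<open>LOsep X c x \<Phi> \<alpha> y\<close>: \<^term>\<open>y\<close> is an admissible answer.  For \<open>\<Phi> = 0\<close>, which can only
  occur when the exact initial estimate of LCG is 0, every admissible answer is of the second kind.
\<close>

definition LOsep :: "'a::real_inner set \<Rightarrow> 'a \<Rightarrow> 'a \<Rightarrow> real \<Rightarrow> real \<Rightarrow> 'a \<Rightarrow> bool" where
  "LOsep X c x \<Phi> \<alpha> y \<longleftrightarrow>
     y extreme_point_of X \<and>
     (inner c (x - y) > \<Phi> / \<alpha> \<or>
      is_arg_max (\<lambda>z. inner c (x - z)) (\<lambda>z. z \<in> X) y \<and> inner c (x - y) \<le> \<Phi>)"

text \<open>
  An execution of LCG is recorded by the sequences \<open>u\<^sub>t\<close>, \<open>v\<^sub>t\<close>, \<open>\<Phi>\<^sub>t\<close>, \<open>\<lambda>\<^sub>t\<close>.  Entries after the stopping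
  iteration are irrelevant; an execution that never stops is recorded as well.
\<close>

record 'a lcg_trace =
  pt :: "nat \<Rightarrow> 'a"
  vert :: "nat \<Rightarrow> 'a"
  est :: "nat \<Rightarrow> real"
  stepsize :: "nat \<Rightarrow> real"

definition lcg_improving :: "('a::real_inner \<Rightarrow> 'a) \<Rightarrow> real \<Rightarrow> 'a lcg_trace \<Rightarrow> nat \<Rightarrow> bool" where
  "lcg_improving \<phi>' \<alpha> T t \<longleftrightarrow>
     inner (\<phi>' (pt T t)) (pt T t - vert T t) > est T (t - 1) / \<alpha>"

definition lcg_stops_at ::
  "('a::real_inner \<Rightarrow> 'a) \<Rightarrow> real \<Rightarrow> real \<Rightarrow> 'a lcg_trace \<Rightarrow> nat \<Rightarrow> bool" where
  "lcg_stops_at \<phi>' \<alpha> \<eta> T t \<longleftrightarrow> t \<ge> 1 \<and> \<not> lcg_improving \<phi>' \<alpha> T t \<and> est T (t - 1) = \<eta>"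

text \<open>
  Two rules for \<open>\<Phi>\<^sub>0\<close>, given the gap \<open>G = max\<^sub>u \<nabla>\<phi>(u\<^sub>1)\<^sup>T(u\<^sub>1 - u)\<close> and the accuracy \<open>\<eta>\<close>.  The first is
  the literal one.  With it \<open>\<Phi>\<^sub>0 < \<eta>\<close> is possible, and then (for \<open>\<alpha> > 1\<close>) a call can need of the
  order of \<open>\<beta>D\<^sup>2/\<Phi>\<^sub>0\<close> iterations, which is not bounded in terms of \<open>\<eta>\<close>.  The second rule keeps the
  estimate at least \<open>\<eta>\<close>, as the update \<open>max {\<Phi>/2, \<eta>}\<close> does; both agree if \<open>G \<ge> \<eta>\<close>.
\<close>

definition exact_start :: "real \<Rightarrow> real \<Rightarrow> real" where
  "exact_start G \<eta> = G"

definition clipped_start :: "real \<Rightarrow> real \<Rightarrow> real" where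
  "clipped_start G \<eta> = max G \<eta>"

definition lcg_run ::
  "'a::real_inner set \<Rightarrow> (real \<Rightarrow> real \<Rightarrow> real) \<Rightarrow> ('a \<Rightarrow> real) \<Rightarrow> ('a \<Rightarrow> 'a) \<Rightarrow> real \<Rightarrow> real \<Rightarrow>
   'a \<Rightarrow> 'a lcg_trace \<Rightarrow> bool" where
  "lcg_run X start \<phi> \<phi>' \<alpha> \<eta> u1 T \<longleftrightarrow>
     pt T 1 = u1 \<and>
     est T 0 = start (SUP w\<in>X. inner (\<phi>' u1) (u1 - w)) \<eta> \<and>
     (\<forall>t\<ge>1. (\<forall>s<t. \<not> lcg_stops_at \<phi>' \<alpha> \<eta> T s) \<longrightarrow>
        LOsep X (\<phi>' (pt T t)) (pt T t) (est T (t - 1)) \<alpha> (vert T t) \<and>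
        (\<not> lcg_stops_at \<phi>' \<alpha> \<eta> T t \<longrightarrow>
           est T t = (if lcg_improving \<phi>' \<alpha> T t then est T (t - 1)
                      else max (est T (t - 1) / 2) \<eta>) \<and>
           is_arg_min (\<lambda>l. \<phi> ((1 - l) *\<^sub>R pt T t + l *\<^sub>R vert T t)) (\<lambda>l. l \<in> {0..1})
             (stepsize T t) \<and>
           pt T (t + 1) = (1 - stepsize T t) *\<^sub>R pt T t + stepsize T t *\<^sub>R vert T t))"

definition lcg_terminates ::
  "('a::real_inner \<Rightarrow> 'a) \<Rightarrow> real \<Rightarrow> real \<Rightarrow> 'a lcg_trace \<Rightarrow> bool" where
  "lcg_terminates \<phi>' \<alpha> \<eta> T \<longleftrightarrow> (\<exists>t. lcg_stops_at \<phi>' \<alpha> \<eta> T t)"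

text \<open>
  Iterations are counted from 1 and each makes exactly one oracle call, so the stopping iteration
  is also the number of calls to the weak separation oracle.  Meaningful for terminating executions
  only.
\<close>

definition lcg_calls :: "('a::real_inner \<Rightarrow> 'a) \<Rightarrow> real \<Rightarrow> real \<Rightarrow> 'a lcg_trace \<Rightarrow> nat" where
  "lcg_calls \<phi>' \<alpha> \<eta> T = (LEAST t. lcg_stops_at \<phi>' \<alpha> \<eta> T t)"

definition lcg_output :: "('a::real_inner \<Rightarrow> 'a) \<Rightarrow> real \<Rightarrow> real \<Rightarrow> 'a lcg_trace \<Rightarrow> 'a" where
  "lcg_output \<phi>' \<alpha> \<eta> T = pt T (lcg_calls \<phi>' \<alpha> \<eta> T)"


section \<open>CALGD\<close>

definition prox_obj :: "'a::real_inner \<Rightarrow> real \<Rightarrow> 'a \<Rightarrow> 'a \<Rightarrow> real" where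
  "prox_obj g \<beta> x u = inner g u + \<beta> / 2 * (norm (u - x))\<^sup>2"

definition prox_grad :: "'a::real_inner \<Rightarrow> real \<Rightarrow> 'a \<Rightarrow> 'a \<Rightarrow> 'a" where
  "prox_grad g \<beta> x u = g + \<beta> *\<^sub>R (u - x)"

record 'a calgd_trace =
  xs :: "nat \<Rightarrow> 'a"
  ys :: "nat \<Rightarrow> 'a"
  zs :: "nat \<Rightarrow> 'a"
  lcg :: "nat \<Rightarrow> 'a lcg_trace"

definition sub_grad_at ::
  "('a::real_inner \<Rightarrow> 'a) \<Rightarrow> (nat \<Rightarrow> real) \<Rightarrow> 'a calgd_trace \<Rightarrow> nat \<Rightarrow> 'a \<Rightarrow> 'a" where
  "sub_grad_at f' \<beta> R k = prox_grad (f' (zs R k)) (\<beta> k) (xs R (k - 1))"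

definition calgd_run ::
  "'a::real_inner set \<Rightarrow> ('a \<Rightarrow> 'a) \<Rightarrow> (real \<Rightarrow> real \<Rightarrow> real) \<Rightarrow> real \<Rightarrow>
   (nat \<Rightarrow> real) \<Rightarrow> (nat \<Rightarrow> real) \<Rightarrow> (nat \<Rightarrow> real) \<Rightarrow> 'a \<Rightarrow> nat \<Rightarrow> 'a calgd_trace \<Rightarrow> bool" where
  "calgd_run X f' start \<alpha> \<beta> \<gamma> \<eta> x0 N R \<longleftrightarrow>
     xs R 0 = x0 \<and> ys R 0 = x0 \<and>
     (\<forall>k\<in>{1..N}.
        zs R k = (1 - \<gamma> k) *\<^sub>R ys R (k - 1) + \<gamma> k *\<^sub>R xs R (k - 1) \<and>
        lcg_run X start (prox_obj (f' (zs R k)) (\<beta> k) (xs R (k - 1))) (sub_grad_at f' \<beta> R k)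
          \<alpha> (\<eta> k) (xs R (k - 1)) (lcg R k) \<and>
        xs R k = lcg_output (sub_grad_at f' \<beta> R k) \<alpha> (\<eta> k) (lcg R k) \<and>
        ys R k = (1 - \<gamma> k) *\<^sub>R ys R (k - 1) + \<gamma> k *\<^sub>R xs R k)"

text \<open>
  The first-order oracle is queried once per outer iteration, at \<open>z\<^sub>k\<close>; the gradients used inside
  LCG are obtained from \<open>f'(z\<^sub>k)\<close> without further queries.
\<close>

definition FO_calls :: "nat \<Rightarrow> nat" where
  "FO_calls N = (\<Sum>k=1..N. 1)"

definition LO_calls ::
  "('a::real_inner \<Rightarrow> 'a) \<Rightarrow> real \<Rightarrow> (nat \<Rightarrow> real) \<Rightarrow> (nat \<Rightarrow> real) \<Rightarrow> nat \<Rightarrow> 'a calgd_trace \<Rightarrow> nat"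
  where
  "LO_calls f' \<alpha> \<beta> \<eta> N R = (\<Sum>k=1..N. lcg_calls (sub_grad_at f' \<beta> R k) \<alpha> (\<eta> k) (lcg R k))"

definition beta_seq :: "real \<Rightarrow> nat \<Rightarrow> real" where
  "beta_seq L k = 3 * L / (real k + 1)"

definition gamma_seq :: "nat \<Rightarrow> real" where
  "gamma_seq k = 3 / (real k + 2)"

definition eta_seq :: "real \<Rightarrow> real \<Rightarrow> nat \<Rightarrow> real" where
  "eta_seq L D k = L * D\<^sup>2 / (real k * (real k + 1))"

definition conv_bound :: "real \<Rightarrow> real \<Rightarrow> nat \<Rightarrow> real" where
  "conv_bound L D k = 15 * L * D\<^sup>2 / (2 * (real k + 1) * (real k + 2))"

definition outer_iters :: "real \<Rightarrow> real \<Rightarrow> real \<Rightarrow> nat" where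
  "outer_iters L D \<epsilon> = (LEAST k. k \<ge> 1 \<and> conv_bound L D k \<le> \<epsilon>)"

end

theory Submission
  imports Defs
begin

text \<open>
  Convergence: each outer step gives
  \<open>f(y\<^sub>k) - f(x) \<le> (1 - \<gamma>\<^sub>k)(f(y\<^sub>k\<^sub>-\<^sub>1) - f(x)) + \<gamma>\<^sub>k\<eta>\<^sub>k + \<gamma>\<^sub>k\<beta>\<^sub>k/2 (r\<^sub>k\<^sub>-\<^sub>1 - r\<^sub>k)\<close> with
  \<open>r\<^sub>k = \<parallel>x\<^sub>k - x\<parallel>\<^sup>2\<close>, because \<open>L\<gamma>\<^sub>k \<le> \<beta>\<^sub>k\<close>, and this telescopes after multiplication by \<open>k(k + 1)(k + 2)\<close>.

  Oracle calls: in LCG an improving iteration decreases \<open>\<phi>\<close> by at least \<open>1 / w(\<Phi>)\<close>, where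
  \<open>w(\<Phi>) = 2\<alpha>/\<Phi> + 2\<alpha>\<^sup>2\<beta>D\<^sup>2/\<Phi>\<^sup>2\<close>, and a non-improving one certifies \<open>\<phi> - inf \<phi> \<le> \<Phi>\<close> before \<open>\<Phi>\<close> is
  halved.  Hence the potential \<open>(\<phi> - inf \<phi>) w(\<Phi>) + R(\<Phi>)\<close> with a suitable \<open>R\<close> drops by 1 in every
  iteration.  For the \<open>k\<close>-th call it starts at \<open>O(k + log A)\<close>, where \<open>A\<close> depends on the gradient of \<open>f\<close>;
  the logarithm is absorbed once the number of outer iterations exceeds it.
\<close>

section \<open>Smooth convex functions\<close>

lemma subspace_Rspace: "subspace (Rspace n)"
  by (auto simp: subspace_def Rspace_def zero_fseq.rep_eq plus_fseq.rep_eq scaleR_fseq.rep_eq)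

text \<open>The supremum is at least its value at \<open>sgn \<xi>\<close>, a member of
  \<open>V\<close> because \<open>V\<close> is a subspace. This turns the Lipschitz hypothesis,
  stated in the conjugate norm over \<open>Rspace n\<close>, into one for the ambient norm.\<close>

lemma norm_le_conj_norm:
  fixes \<xi> :: "'a::real_inner"
  assumes "subspace V" "\<xi> \<in> V"
  shows "norm \<xi> \<le> conj_norm V \<xi>"
proof -
  have bdd: "bdd_above (inner \<xi> ` {w \<in> V. norm w \<le> 1})"
  proof (rule bdd_aboveI2)
    fix w assume w: "w \<in> {w \<in> V. norm w \<le> 1}"
    have "inner \<xi> w \<le> norm \<xi> * norm w"
      by (rule norm_cauchy_schwarz)
    also have "\<dots> \<le> norm \<xi> * 1"
      using w by (intro mult_left_mono) auto
    finally show "inner \<xi> w \<le> norm \<xi>" by simp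
  qed
  have "sgn \<xi> \<in> {w \<in> V. norm w \<le> 1}"
    using assms by (simp add: norm_sgn subspace_scale[of V \<xi> "inverse (norm \<xi>)", folded sgn_div_norm])
  then have "inner \<xi> (sgn \<xi>) \<le> conj_norm V \<xi>"
    unfolding conj_norm_def by (rule cSUP_upper[OF _ bdd])
  moreover have "inner \<xi> (sgn \<xi>) = norm \<xi>"
    by (cases "\<xi> = 0") (simp_all add: sgn_div_norm dot_square_norm power2_eq_square)
  ultimately show ?thesis by simp
qed

text \<open>Chain rule with all derivatives taken within sets: convexity keeps the segment inside
  \<open>X\<close>, so a gradient relative to \<open>X\<close> suffices even when \<open>X\<close>
  has empty interior.\<close>

lemma segment_has_derivative:
  fixes f :: "'a::real_inner \<Rightarrow> real"
  assumes "convex X" "x \<in> X" "y \<in> X"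
    and der: "\<And>z. z \<in> X \<Longrightarrow> (f has_derivative (\<lambda>h. inner (f' z) h)) (at z within X)"
    and t: "t \<in> {0..1}"
  shows "((\<lambda>t. f (x + t *\<^sub>R (y - x))) has_derivative
           (\<lambda>h. h * inner (f' (x + t *\<^sub>R (y - x))) (y - x))) (at t within {0..1})"
proof -
  have sub: "(\<lambda>t. x + t *\<^sub>R (y - x)) ` {0..1} \<subseteq> X"
  proof clarify
    fix s :: real assume "s \<in> {0..1}"
    then have "(1 - s) *\<^sub>R x + s *\<^sub>R y \<in> X"
      using assms by (intro convexD) auto
    then show "x + s *\<^sub>R (y - x) \<in> X" by (simp add: algebra_simps)
  qed
  have "((\<lambda>t. x + t *\<^sub>R (y - x)) has_derivative (\<lambda>h. h *\<^sub>R (y - x))) (at t within {0..1})"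
    by (auto intro!: derivative_eq_intros)
  moreover have "(f has_derivative (\<lambda>h. inner (f' (x + t *\<^sub>R (y - x))) h))
      (at (x + t *\<^sub>R (y - x)) within (\<lambda>t. x + t *\<^sub>R (y - x)) ` {0..1})"
    using sub t by (intro has_derivative_subset[OF der sub]) blast
  ultimately have "(f \<circ> (\<lambda>t. x + t *\<^sub>R (y - x)) has_derivative
      (\<lambda>h. inner (f' (x + t *\<^sub>R (y - x))) h) \<circ> (\<lambda>h. h *\<^sub>R (y - x))) (at t within {0..1})"
    by (rule diff_chain_within)
  then show ?thesis by (simp add: o_def)
qed

text \<open>Convexity bounds every difference quotient along the segment by
  \<open>f y - f x\<close>, and their one-sided limit at 0 is the directional derivative.\<close>

lemma convex_on_gradient_le:
  fixes f :: "'a::real_inner \<Rightarrow> real"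
  assumes cf: "convex_on X f" and x: "x \<in> X" and y: "y \<in> X"
    and der: "\<And>z. z \<in> X \<Longrightarrow> (f has_derivative (\<lambda>h. inner (f' z) h)) (at z within X)"
  shows "f x + inner (f' x) (y - x) \<le> f y"
proof -
  let ?g = "\<lambda>t. f (x + t *\<^sub>R (y - x))"
  have "(?g has_derivative (\<lambda>h. h * inner (f' (x + 0 *\<^sub>R (y - x))) (y - x))) (at 0 within {0..1})"
    by (rule segment_has_derivative[OF convex_on_imp_convex[OF cf] x y der]) auto
  then have "(?g has_field_derivative inner (f' x) (y - x)) (at 0 within {0..1})"
    by (simp add: has_field_derivative_def mult.commute[of _ "inner _ _"])
  then have lim: "((\<lambda>t. (?g t - ?g 0) / (t - 0)) \<longlongrightarrow> inner (f' x) (y - x)) (at 0 within {0..1})"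
    by (simp add: has_field_derivative_iff)
  have nt: "at (0::real) within {0..1} \<noteq> bot"
    by (simp add: trivial_limit_within islimpt_Icc)
  have "inner (f' x) (y - x) \<le> f y - f x"
  proof (rule tendsto_upperbound[OF lim _ nt])
    have "(?g t - ?g 0) / (t - 0) \<le> f y - f x" if "t \<in> {0..1}" "t \<noteq> 0" for t :: real
    proof -
      have "?g t = f ((1 - t) *\<^sub>R x + t *\<^sub>R y)" by (simp add: algebra_simps)
      also have "\<dots> \<le> (1 - t) * f x + t * f y"
        using that by (intro convex_onD[OF cf] x y) auto
      finally show ?thesis using that by (simp add: field_simps)
    qed
    then show "\<forall>\<^sub>F t in at 0 within {0..1}. (?g t - ?g 0) / (t - 0) \<le> f y - f x"
      by (auto simp: eventually_at_filter)
  qed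
  then show ?thesis by simp
qed

text \<open>\<open>?h\<close> is \<open>f\<close> along the segment minus the linear and quadratic
  terms. The mean value theorem makes its increment over [0,1] a derivative at an interior point,
  nonpositive by the Lipschitz bound.\<close>

lemma descent_lemma:
  fixes f :: "'a::real_inner \<Rightarrow> real"
  assumes cX: "convex X" and x: "x \<in> X" and y: "y \<in> X"
    and der: "\<And>z. z \<in> X \<Longrightarrow> (f has_derivative (\<lambda>h. inner (f' z) h)) (at z within X)"
    and lip: "\<And>u v. u \<in> X \<Longrightarrow> v \<in> X \<Longrightarrow> norm (f' u - f' v) \<le> L * norm (u - v)"
  shows "f y \<le> f x + inner (f' x) (y - x) + L / 2 * (norm (y - x))\<^sup>2"
proof -
  define d where "d = y - x"
  let ?p = "\<lambda>t. x + t *\<^sub>R d"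
  let ?h = "\<lambda>t. f (?p t) - t * inner (f' x) d - L / 2 * t\<^sup>2 * (norm d)\<^sup>2"
  let ?h' = "\<lambda>t h. h * inner (f' (?p t)) d - h * inner (f' x) d - L * t * h * (norm d)\<^sup>2"
  have "(?h has_derivative ?h' t) (at t within {0..1})" if "t \<in> {0..1}" for t
    by (rule derivative_eq_intros segment_has_derivative[OF cX x y der that, folded d_def] refl
        | simp add: algebra_simps)+
  then obtain t where t: "t \<in> {0<..<1}" and eq: "?h 1 - ?h 0 = ?h' t (1 - 0)"
    using mvt_simple[of 0 1 ?h ?h'] by auto
  have pX: "?p t \<in> X"
  proof -
    have "(1 - t) *\<^sub>R x + t *\<^sub>R y \<in> X" using cX x y t by (intro convexD) auto
    then show ?thesis by (simp add: algebra_simps d_def)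
  qed
  have "inner (f' (?p t) - f' x) d \<le> norm (f' (?p t) - f' x) * norm d"
    by (rule norm_cauchy_schwarz)
  also have "\<dots> \<le> (L * norm (?p t - x)) * norm d"
    by (intro mult_right_mono lip pX x) simp
  also have "\<dots> = L * t * (norm d)\<^sup>2"
    using t by (simp add: power2_eq_square)
  finally have "?h 1 - ?h 0 \<le> 0"
    unfolding eq by (simp add: inner_diff_left)
  then show ?thesis by (simp add: d_def)
qed

lemma diameter_norm_le:
  fixes X :: "'a::real_normed_vector set"
  assumes "bounded X" "x \<in> X" "y \<in> X"
  shows "norm (x - y) \<le> diameter X"
  using diameter_bounded_bound[OF assms] by (simp add: dist_norm)


section \<open>The LCG procedure\<close>

text \<open>\<open>\<phi>\<close> enters only through a linear lower and a quadratic upper model on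
  \<open>X\<close>. In a run of CALGD, \<open>\<eta> = 0\<close> arises only when \<open>X\<close>
  is a single point; \<open>lcg_stops_at_1\<close> treats that case.\<close>

locale lcg_execution =
  fixes X :: "'a::real_inner set" and start :: "real \<Rightarrow> real \<Rightarrow> real"
    and \<phi> :: "'a \<Rightarrow> real" and \<phi>' :: "'a \<Rightarrow> 'a" and \<alpha> \<eta> :: real and u1 :: 'a
    and T :: "'a lcg_trace" and \<beta> D :: real
  assumes run: "lcg_run X start \<phi> \<phi>' \<alpha> \<eta> u1 T"
    and start: "start \<in> {exact_start, clipped_start}"
    and \<alpha>: "\<alpha> \<ge> 1" and \<eta>: "\<eta> > 0" and \<beta>: "\<beta> \<ge> 0"
    and cX: "convex X" and u1: "u1 \<in> X"
    and diam: "\<And>u w. u \<in> X \<Longrightarrow> w \<in> X \<Longrightarrow> norm (u - w) \<le> D"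
    and grad: "\<And>u w. u \<in> X \<Longrightarrow> w \<in> X \<Longrightarrow> \<phi> u + inner (\<phi>' u) (w - u) \<le> \<phi> w"
    and smooth: "\<And>u w. u \<in> X \<Longrightarrow> w \<in> X \<Longrightarrow>
      \<phi> w \<le> \<phi> u + inner (\<phi>' u) (w - u) + \<beta> / 2 * (norm (w - u))\<^sup>2"
begin

section \<open>Initial gap, initial estimate and optimal value\<close>

definition "initial_gap = (SUP w\<in>X. inner (\<phi>' u1) (u1 - w))"

text \<open>Marks the iterations that are reached, the stopping one included; later entries of the
  trace are unconstrained.\<close>

definition "active t \<longleftrightarrow> t \<ge> 1 \<and> (\<forall>s<t. \<not> lcg_stops_at \<phi>' \<alpha> \<eta> T s)"

definition "inf_\<phi> = (INF w\<in>X. \<phi> w)"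

lemma gap_le: "u \<in> X \<Longrightarrow> w \<in> X \<Longrightarrow> inner (\<phi>' u) (u - w) \<le> norm (\<phi>' u) * D"
  by (rule order_trans[OF norm_cauchy_schwarz]) (auto intro!: mult_left_mono diam)

lemma initial_gap_upper: "w \<in> X \<Longrightarrow> inner (\<phi>' u1) (u1 - w) \<le> initial_gap"
  unfolding initial_gap_def by (rule cSUP_upper) (auto intro!: bdd_aboveI2 gap_le u1)

lemma initial_gap_le: "initial_gap \<le> norm (\<phi>' u1) * D"
  unfolding initial_gap_def using u1 by (intro cSUP_least gap_le) auto

lemma initial_gap_nonneg: "0 \<le> initial_gap"
  using initial_gap_upper[OF u1] by simp

lemma est_0: "est T 0 = start initial_gap \<eta>"
  using run by (simp add: lcg_run_def initial_gap_def)

lemma initial_gap_le_est: "initial_gap \<le> est T 0"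
  using start by (auto simp: est_0 exact_start_def clipped_start_def)

lemma est_0_le: "est T 0 \<le> max initial_gap \<eta>"
  using start by (auto simp: est_0 exact_start_def clipped_start_def)

lemma pt_1: "pt T 1 = u1"
  using run by (simp add: lcg_run_def)

lemma inf_le:
  assumes "u \<in> X"
  shows "inf_\<phi> \<le> \<phi> u"
proof -
  \<comment> \<open>The linear model at \<open>u1\<close> bounds \<open>\<phi>\<close> below on
    \<open>X\<close>, so that the real infimum is a genuine one.\<close>
  have "\<phi> u1 - initial_gap \<le> \<phi> w" if "w \<in> X" for w
    using grad[OF u1 that] initial_gap_upper[OF that] by (simp add: inner_diff_right)
  then show ?thesis
    unfolding inf_\<phi>_def by (intro cINF_lower assms bdd_belowI2)
qed

text \<open>By the linear lower model the Frank-Wolfe gap dominates the primal gap; this turns an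
  oracle certificate into a bound on \<open>\<phi>\<close>.\<close>

lemma primal_gap_le:
  assumes "u \<in> X" "\<And>w. w \<in> X \<Longrightarrow> inner (\<phi>' u) (u - w) \<le> g"
  shows "\<phi> u - inf_\<phi> \<le> g"
proof -
  have "\<phi> u - g \<le> \<phi> w" if "w \<in> X" for w
    using grad[OF assms(1) that] assms(2)[OF that] by (simp add: inner_diff_right)
  then have "\<phi> u - g \<le> inf_\<phi>"
    unfolding inf_\<phi>_def using u1 by (intro cINF_greatest) auto
  then show ?thesis by simp
qed

section \<open>Reached iterations: feasibility and oracle certificates\<close>

lemma active_1: "active 1"
  by (auto simp: active_def lcg_stops_at_def)

lemma active_Suc: "active t \<Longrightarrow> \<not> lcg_stops_at \<phi>' \<alpha> \<eta> T t \<Longrightarrow> active (Suc t)"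
  by (auto simp: active_def less_Suc_eq)

lemma active_SucD: "active (Suc t) \<Longrightarrow> t \<ge> 1 \<Longrightarrow> active t \<and> \<not> lcg_stops_at \<phi>' \<alpha> \<eta> T t"
  by (auto simp: active_def)

lemma active_LOsep:
  assumes "active t"
  shows "LOsep X (\<phi>' (pt T t)) (pt T t) (est T (t - 1)) \<alpha> (vert T t)"
  using run assms by (auto simp: lcg_run_def active_def)

lemma vert_in: "active t \<Longrightarrow> vert T t \<in> X"
  using active_LOsep[of t] by (auto simp: LOsep_def extreme_point_of_def)

lemma step:
  assumes "active t" "\<not> lcg_stops_at \<phi>' \<alpha> \<eta> T t"
  shows est_step: "est T t = (if lcg_improving \<phi>' \<alpha> T t then est T (t - 1)
                               else max (est T (t - 1) / 2) \<eta>)"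
    and line_search: "is_arg_min (\<lambda>l. \<phi> ((1 - l) *\<^sub>R pt T t + l *\<^sub>R vert T t))
                        (\<lambda>l. l \<in> {0..1}) (stepsize T t)"
    and pt_step: "pt T (Suc t) = (1 - stepsize T t) *\<^sub>R pt T t + stepsize T t *\<^sub>R vert T t"
  using run assms unfolding lcg_run_def active_def Suc_eq_plus1 by blast+

lemma pt_in: "active t \<Longrightarrow> pt T t \<in> X"
proof (induction t)
  case 0
  then show ?case by (simp add: active_def)
next
  case (Suc t)
  show ?case
  proof (cases "t = 0")
    case True
    then show ?thesis using pt_1 u1 by simp
  next
    case False
    then have act: "active t" "\<not> lcg_stops_at \<phi>' \<alpha> \<eta> T t"
      using active_SucD[OF Suc.prems] by auto
    have "stepsize T t \<in> {0..1}"
      using line_search[OF act] by (simp add: is_arg_min_def)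
    then show ?thesis
      unfolding pt_step[OF act] using cX Suc.IH[OF act(1)] vert_in[OF act(1)]
      by (intro convexD) auto
  qed
qed

text \<open>A non-improving answer must be of the second oracle kind, an exact maximizer of the gap,
  so the bound on its own gap extends to all of \<open>X\<close>.\<close>

lemma not_improving_gap_le:
  assumes "active t" "\<not> lcg_improving \<phi>' \<alpha> T t" "w \<in> X"
  shows "inner (\<phi>' (pt T t)) (pt T t - w) \<le> est T (t - 1)"
proof -
  have "is_arg_max (\<lambda>z. inner (\<phi>' (pt T t)) (pt T t - z)) (\<lambda>z. z \<in> X) (vert T t)"
    and le: "inner (\<phi>' (pt T t)) (pt T t - vert T t) \<le> est T (t - 1)"
    using active_LOsep[OF assms(1)] assms(2) by (auto simp: LOsep_def lcg_improving_def)
  then have "inner (\<phi>' (pt T t)) (pt T t - w) \<le> inner (\<phi>' (pt T t)) (pt T t - vert T t)"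
    using assms(3) by (auto simp: is_arg_max_linorder)
  with le show ?thesis by simp
qed

section \<open>Decrease of the objective in one line search\<close>

lemma line_search_le:
  assumes act: "active t" "\<not> lcg_stops_at \<phi>' \<alpha> \<eta> T t" and l: "l \<in> {0..1}"
  shows "\<phi> (pt T (Suc t)) \<le> \<phi> (pt T t) - l * inner (\<phi>' (pt T t)) (pt T t - vert T t)
           + l\<^sup>2 * (\<beta> * D\<^sup>2) / 2"
proof -
  let ?u = "pt T t" and ?v = "vert T t"
  let ?w = "(1 - l) *\<^sub>R ?u + l *\<^sub>R ?v"
  have X: "?u \<in> X" "?v \<in> X" using act pt_in vert_in by auto
  have wX: "?w \<in> X" using cX X l by (intro convexD) auto
  have w: "?w - ?u = l *\<^sub>R (?v - ?u)" by (simp add: algebra_simps)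
  \<comment> \<open>Exact line search is no worse than the fixed step \<open>l\<close>, whose value
    the quadratic model controls.\<close>
  have "\<phi> (pt T (Suc t)) \<le> \<phi> ?w"
    using line_search[OF act] l unfolding pt_step[OF act] by (auto simp: is_arg_min_linorder)
  also have "\<dots> \<le> \<phi> ?u + inner (\<phi>' ?u) (?w - ?u) + \<beta> / 2 * (norm (?w - ?u))\<^sup>2"
    by (rule smooth) fact+
  also have "\<dots> = \<phi> ?u - l * inner (\<phi>' ?u) (?u - ?v) + l\<^sup>2 * (\<beta> * (norm (?v - ?u))\<^sup>2) / 2"
    unfolding w norm_scaleR power_mult_distrib
    by (simp add: inner_diff_right algebra_simps)
  also have "\<dots> \<le> \<phi> ?u - l * inner (\<phi>' ?u) (?u - ?v) + l\<^sup>2 * (\<beta> * D\<^sup>2) / 2"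
    using \<beta> diam[OF X(2,1)]
    by (intro add_left_mono divide_right_mono mult_left_mono power_mono) auto
  finally show ?thesis .
qed

lemma pt_step_le:
  "active t \<Longrightarrow> \<not> lcg_stops_at \<phi>' \<alpha> \<eta> T t \<Longrightarrow> \<phi> (pt T (Suc t)) \<le> \<phi> (pt T t)"
  using line_search_le[of t 0] by simp

section \<open>The potential and its decrease\<close>

definition "weight \<Phi> = 2 * \<alpha> / \<Phi> + 2 * \<alpha>\<^sup>2 * (\<beta> * D\<^sup>2) / \<Phi>\<^sup>2"

lemma curvature_nonneg: "0 \<le> \<beta> * D\<^sup>2"
  using \<beta> by simp

lemma weight_pos: "\<Phi> > 0 \<Longrightarrow> weight \<Phi> > 0"
  unfolding weight_def using \<alpha> curvature_nonneg by (intro add_pos_nonneg) auto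

lemma improving_decrease:
  assumes act: "active t" "\<not> lcg_stops_at \<phi>' \<alpha> \<eta> T t"
    and imp: "lcg_improving \<phi>' \<alpha> T t" and pos: "est T (t - 1) > 0"
  shows "\<phi> (pt T (Suc t)) + 1 / weight (est T (t - 1)) \<le> \<phi> (pt T t)"
proof -
  define P where "P = est T (t - 1)"
  define B where "B = \<beta> * D\<^sup>2"
  have P: "P > 0" and B: "B \<ge> 0" using pos curvature_nonneg by (auto simp: P_def B_def)
  \<comment> \<open>A smooth substitute for the step min(1, P / (\<alpha> B)): it lies in [0,1],
    also for \<open>B = 0\<close>, and satisfies \<open>l * B \<le> P / \<alpha>\<close>, so the
    quadratic term costs at most half of the linear gain.\<close>
  define l where "l = P / (P + \<alpha> * B)"
  have den: "P + \<alpha> * B > 0" using P B \<alpha> by (intro add_pos_nonneg) auto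
  have l: "l \<in> {0..1}" "l > 0" using P B \<alpha> den by (auto simp: l_def field_simps)
  have "l * (P / \<alpha>) \<le> l * inner (\<phi>' (pt T t)) (pt T t - vert T t)"
    using imp l by (intro mult_left_mono) (auto simp: lcg_improving_def P_def)
  then have "\<phi> (pt T (Suc t)) \<le> \<phi> (pt T t) - l * (P / \<alpha>) + l * (l * B) / 2"
    using line_search_le[OF act l(1)] by (simp add: B_def power2_eq_square)
  also have "l * (l * B) \<le> l * (P / \<alpha>)"
  proof (intro mult_left_mono)
    show "l * B \<le> P / \<alpha>" using den P B \<alpha> by (simp add: l_def field_simps)
  qed (use l in auto)
  also have "\<phi> (pt T t) - l * (P / \<alpha>) + l * (P / \<alpha>) / 2 = \<phi> (pt T t) - l * P / (2 * \<alpha>)"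
    by simp
  also have "l * P / (2 * \<alpha>) = 1 / weight P"
  proof -
    have "weight P = 2 * \<alpha> * (P + \<alpha> * B) / P\<^sup>2"
      using P by (simp add: weight_def B_def field_simps power2_eq_square)
    then show ?thesis by (simp add: l_def power2_eq_square)
  qed
  finally show ?thesis by (simp add: P_def)
qed

text \<open>The first case concerns an exact initial estimate below \<open>\<eta>\<close>, which is raised to \<open>\<eta>\<close> at the first
  non-improving iteration.  In the last case \<open>3 / \<eta> - 2 / \<Phi>\<close> dominates the sum of the reciprocals of
  the later estimates.\<close>

definition "later_iters \<Phi> =
  (if \<Phi> < \<eta> then 1 + \<eta> * weight \<eta>
   else if \<Phi> = \<eta> then 0
   else (4 * \<alpha> + 1) * (log 2 (\<Phi> / \<eta>) + 1) + 4 * \<alpha>\<^sup>2 * (\<beta> * D\<^sup>2) * (3 / \<eta> - 2 / \<Phi>))"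

definition "potential t =
  (\<phi> (pt T t) - inf_\<phi>) * weight (est T (t - 1)) + later_iters (est T (t - 1))"

lemma scaled_weight: "\<Phi> > 0 \<Longrightarrow> \<Phi> * weight \<Phi> = 2 * \<alpha> + 2 * \<alpha>\<^sup>2 * (\<beta> * D\<^sup>2) / \<Phi>"
  by (simp add: weight_def field_simps power2_eq_square)

text \<open>The recursion that \<open>later_iters\<close> is built to satisfy. After a non-improving
  iteration the primal gap is at most both \<Phi> and 2 \<Psi>; the left side is then the new
  potential, plus 1 for the iteration itself.\<close>

lemma later_iters_halve:
  assumes "\<Phi> > 0" "\<Phi> \<noteq> \<eta>" and \<Psi>: "\<Psi> = max (\<Phi> / 2) \<eta>"
  shows "min \<Phi> (2 * \<Psi>) * weight \<Psi> + later_iters \<Psi> + 1 \<le> later_iters \<Phi>"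
proof -
  define B where "B = 4 * \<alpha>\<^sup>2 * (\<beta> * D\<^sup>2)"
  have B: "B \<ge> 0" using curvature_nonneg by (simp add: B_def)
  have \<Psi>0: "\<Psi> > 0" using \<eta> \<Psi> by auto
  have w: "2 * \<Psi> * weight \<Psi> = 4 * \<alpha> + B / \<Psi>"
    using scaled_weight[OF \<Psi>0] by (simp add: B_def mult.assoc)
  \<comment> \<open>An underestimate raised to \<eta>, a last halving cut off at \<eta>, and a full
    halving.\<close>
  consider "\<Phi> < \<eta>" | "\<Phi> > \<eta>" "\<Phi> / 2 \<le> \<eta>" | "\<Phi> / 2 > \<eta>"
    using assms by linarith
  then show ?thesis
  proof cases
    case 1
    then have "\<Psi> = \<eta>" using \<Psi> \<open>\<Phi> > 0\<close> by auto
    moreover have "\<Phi> * weight \<eta> \<le> \<eta> * weight \<eta>"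
      using 1 weight_pos[OF \<eta>] by (intro mult_right_mono) auto
    ultimately show ?thesis using 1 \<eta> by (simp add: later_iters_def)
  next
    case 2
    then have eq: "\<Psi> = \<eta>" using \<Psi> by auto
    have "(4 * \<alpha> + 1) * 1 \<le> (4 * \<alpha> + 1) * (log 2 (\<Phi> / \<eta>) + 1)"
      using \<alpha> \<eta> 2 by (intro mult_left_mono) auto
    \<comment> \<open>The constant 3 leaves at least 1/\<eta> even when \<Phi> is close to
      \<eta>.\<close>
    moreover have "B * (1 / \<eta>) \<le> B * (3 / \<eta> - 2 / \<Phi>)"
    proof (intro mult_left_mono B)
      have "2 / \<Phi> \<le> 2 / \<eta>" using 2 \<eta> by (intro divide_left_mono) auto
      then show "1 / \<eta> \<le> 3 / \<eta> - 2 / \<Phi>" by (simp add: diff_divide_distrib[symmetric] field_simps)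
    qed
    moreover have "min \<Phi> (2 * \<Psi>) = \<Phi>" using 2 eq by auto
    moreover have "\<Phi> * weight \<eta> \<le> 4 * \<alpha> + B / \<eta>"
    proof -
      have "\<Phi> * weight \<eta> \<le> (2 * \<eta>) * weight \<eta>"
        using 2 weight_pos[OF \<eta>] by (intro mult_right_mono) auto
      then show ?thesis using w eq by simp
    qed
    ultimately show ?thesis using 2 eq by (simp add: later_iters_def B_def)
  next
    case 3
    then have eq: "\<Psi> = \<Phi> / 2" and "\<Phi> > \<eta>" using \<Psi> \<eta> by auto
    have lg: "log 2 (\<Phi> / 2 / \<eta>) = log 2 (\<Phi> / \<eta>) - 1"
      using \<eta> \<open>\<Phi> > 0\<close> by (simp add: log_divide log_mult)
    \<comment> \<open>As 2/\<Psi> = 4/\<Phi>, this term drops by exactly the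
      \<open>B / \<Psi>\<close> in the new weighted gap, while the logarithm drops by 1 and pays for
      4 \<alpha> + 1.\<close>
    have B': "B * (3 / \<eta> - 2 / \<Phi>) = B * (3 / \<eta> - 2 / \<Psi>) + B / \<Psi>"
      by (simp add: eq algebra_simps)
    have "later_iters \<Phi> = (4 * \<alpha> + 1) * (log 2 (\<Phi> / \<eta>) + 1) + B * (3 / \<eta> - 2 / \<Phi>)"
      using \<open>\<Phi> > \<eta>\<close> by (simp add: later_iters_def B_def)
    moreover have "later_iters \<Psi> = (4 * \<alpha> + 1) * log 2 (\<Phi> / \<eta>) + B * (3 / \<eta> - 2 / \<Psi>)"
      using 3 lg by (simp add: later_iters_def B_def eq)
    moreover have "min \<Phi> (2 * \<Psi>) * weight \<Psi> = 4 * \<alpha> + B / \<Psi>"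
      using w by (simp add: eq)
    ultimately show ?thesis using B' by (simp add: distrib_left)
  qed
qed

lemma later_iters_nonneg:
  assumes "\<Phi> > 0"
  shows "later_iters \<Phi> \<ge> 0"
proof -
  have "later_iters \<eta> = 0" by (simp add: later_iters_def)
  moreover have "later_iters \<Phi> \<ge> 0" if "\<Phi> < \<eta>"
    using that weight_pos[OF \<eta>] \<eta> by (simp add: later_iters_def)
  moreover have "later_iters \<Phi> \<ge> 0" if "\<Phi> > \<eta>"
  proof -
    have "2 / \<Phi> \<le> 3 / \<eta>" using that \<eta> by (intro frac_le) auto
    then show ?thesis using that \<eta> \<alpha> curvature_nonneg
      by (auto simp: later_iters_def intro!: add_nonneg_nonneg mult_nonneg_nonneg)
  qed
  ultimately show ?thesis by (cases \<Phi> \<eta> rule: linorder_cases) auto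
qed

lemma potential_nonneg:
  assumes "active t" "est T (t - 1) > 0"
  shows "potential t \<ge> 0"
  unfolding potential_def using assms inf_le[OF pt_in] weight_pos later_iters_nonneg
  by (intro add_nonneg_nonneg mult_nonneg_nonneg) (auto intro: less_imp_le)

text \<open>The line search takes place after a non-improving answer too; it cannot increase
  \<open>\<phi>\<close>, so the certificate at \<open>pt T t\<close> carries over to the next
  point.\<close>

lemma not_improving_primal_gap:
  assumes act: "active t" "\<not> lcg_stops_at \<phi>' \<alpha> \<eta> T t" and ni: "\<not> lcg_improving \<phi>' \<alpha> T t"
  shows "\<phi> (pt T (Suc t)) - inf_\<phi> \<le> est T (t - 1)"
  using pt_step_le[OF act] primal_gap_le[OF pt_in[OF act(1)] not_improving_gap_le[OF act(1) ni]]
  by simp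

text \<open>If the iteration improves, the estimate stays and the weighted gap drops by 1. Otherwise
  the old weighted gap is discarded and \<open>later_iters\<close> pays for the new one.\<close>

lemma potential_step:
  assumes act: "active t" "\<not> lcg_stops_at \<phi>' \<alpha> \<eta> T t" and pos: "est T (t - 1) > 0"
  shows "potential (Suc t) + 1 \<le> potential t \<and> est T t > 0"
proof (cases "lcg_improving \<phi>' \<alpha> T t")
  case True
  then have eq: "est T t = est T (t - 1)" using est_step[OF act] by simp
  define w where "w = weight (est T (t - 1))"
  have w: "w > 0" using weight_pos[OF pos] by (simp add: w_def)
  have "(\<phi> (pt T (Suc t)) + 1 / w - inf_\<phi>) * w \<le> (\<phi> (pt T t) - inf_\<phi>) * w"
    using improving_decrease[OF act True pos] w by (intro mult_right_mono) (auto simp: w_def)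
  moreover have "(\<phi> (pt T (Suc t)) + 1 / w - inf_\<phi>) * w = (\<phi> (pt T (Suc t)) - inf_\<phi>) * w + 1"
    using w by (simp add: left_diff_distrib distrib_right)
  ultimately have "(\<phi> (pt T (Suc t)) - inf_\<phi>) * w + 1 \<le> (\<phi> (pt T t) - inf_\<phi>) * w"
    by simp
  then show ?thesis using eq pos by (simp add: potential_def w_def)
next
  case False
  define P where "P = est T (t - 1)"
  define Q where "Q = est T t"
  \<comment> \<open>A non-improving iteration with estimate \<eta> would be the stopping
    one.\<close>
  have ne: "P \<noteq> \<eta>"
    using act False by (auto simp: lcg_stops_at_def active_def P_def)
  have Q: "Q = max (P / 2) \<eta>" using est_step[OF act] False by (simp add: P_def Q_def)
  then have "Q > 0" using \<eta> by auto
  have "\<phi> (pt T (Suc t)) - inf_\<phi> \<le> min P (2 * Q)"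
    using not_improving_primal_gap[OF act False] Q by (auto simp: P_def)
  then have "(\<phi> (pt T (Suc t)) - inf_\<phi>) * weight Q \<le> min P (2 * Q) * weight Q"
    using weight_pos[OF \<open>Q > 0\<close>] by (intro mult_right_mono) auto
  moreover have "0 \<le> (\<phi> (pt T t) - inf_\<phi>) * weight P"
    using inf_le[OF pt_in[OF act(1)]] weight_pos[OF pos]
    by (intro mult_nonneg_nonneg) (auto simp: P_def)
  moreover have "min P (2 * Q) * weight Q + later_iters Q + 1 \<le> later_iters P"
    using pos ne Q by (intro later_iters_halve) (auto simp: P_def)
  ultimately show ?thesis using \<open>Q > 0\<close>
    unfolding potential_def diff_Suc_1 P_def[symmetric] Q_def[symmetric] by simp
qed

section \<open>Termination, iteration count and output\<close>

lemma stops_within_potential: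
  assumes act: "active t" and pos: "est T (t - 1) > 0"
  shows "\<exists>s. lcg_stops_at \<phi>' \<alpha> \<eta> T s \<and> real s \<le> real t + potential t"
proof -
  \<comment> \<open>After \<open>n + 1\<close> iterations from \<open>t\<close> on, either one of
    them has stopped or the potential has fallen by \<open>n + 1\<close>.\<close>
  have *: "(\<exists>j\<le>n. lcg_stops_at \<phi>' \<alpha> \<eta> T (t + j) \<and> real j \<le> potential t) \<or>
      active (t + n + 1) \<and> est T (t + n) > 0 \<and> potential (t + n + 1) + real (n + 1) \<le> potential t"
    for n
  proof (induction n)
    case 0
    then show ?case
      using potential_step[OF act _ pos] active_Suc[OF act] potential_nonneg[OF act pos] by auto
  next
    case (Suc n)
    show ?case
    proof (cases "\<exists>j\<le>n. lcg_stops_at \<phi>' \<alpha> \<eta> T (t + j) \<and> real j \<le> potential t")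
      case True
      then show ?thesis by (meson le_SucI)
    next
      case False
      with Suc have IH: "active (t + n + 1)" "est T (t + n) > 0"
        "potential (t + n + 1) + real (n + 1) \<le> potential t" by auto
      have nn: "potential (t + n + 1) \<ge> 0" using potential_nonneg[OF IH(1)] IH(2) by simp
      show ?thesis
      proof (cases "lcg_stops_at \<phi>' \<alpha> \<eta> T (t + n + 1)")
        case True
        then show ?thesis using IH(3) nn by (intro disjI1 exI[of _ "Suc n"]) auto
      next
        case False
        then show ?thesis
          using potential_step[OF IH(1) False] IH active_Suc[OF IH(1) False] by auto
      qed
    qed
  qed
  \<comment> \<open>For this \<open>n\<close> the second alternative would make the potential
    negative.\<close>
  define n where "n = nat \<lceil>potential t\<rceil>"
  have "real n \<ge> potential t" unfolding n_def by (rule real_nat_ceiling_ge)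
  then have "\<exists>j\<le>n. lcg_stops_at \<phi>' \<alpha> \<eta> T (t + j) \<and> real j \<le> potential t"
    using *[of n] potential_nonneg[of "t + n + 1"] by auto
  then show ?thesis by (metis add_left_mono of_nat_add)
qed

text \<open>The first iteration lifts the estimate to \<eta>, and the potential argument is started
  at iteration 2. This also covers the estimate 0, for which the weight at iteration 1 is
  meaningless.\<close>

lemma stops_after_underestimate:
  assumes lt: "est T 0 < \<eta>" and ni: "\<not> lcg_improving \<phi>' \<alpha> T 1"
  shows "\<exists>s. lcg_stops_at \<phi>' \<alpha> \<eta> T s \<and> real s \<le> 2 + (2 * \<alpha> + 2 * \<alpha>\<^sup>2 * (\<beta> * D\<^sup>2) / \<eta>)"
proof -
  have ns: "\<not> lcg_stops_at \<phi>' \<alpha> \<eta> T 1" using lt by (auto simp: lcg_stops_at_def)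
  have "est T 0 \<ge> 0" using initial_gap_nonneg initial_gap_le_est by simp
  then have e: "est T 1 = \<eta>" using est_step[OF active_1 ns] ni lt \<eta> by auto
  have act: "active 2" using active_Suc[OF active_1 ns] by (simp add: numeral_2_eq_2)
  have "potential 2 \<le> \<eta> * weight \<eta>"
    using not_improving_primal_gap[OF active_1 ns ni] lt weight_pos[OF \<eta>] e
    by (simp add: potential_def numeral_2_eq_2 later_iters_def)
  then show ?thesis
    using stops_within_potential[OF act] e \<eta> scaled_weight[OF \<eta>] by force
qed

text \<open>The initial estimate bounds every gap value at \<open>u1\<close>, so no answer can
  exceed \<Phi>/\<alpha> when \<alpha> = 1 or \<Phi> = 0.\<close>

lemma not_improving_1:
  assumes "est T 0 \<le> 0 \<or> \<alpha> = 1"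
  shows "\<not> lcg_improving \<phi>' \<alpha> T 1"
proof -
  have g: "inner (\<phi>' u1) (u1 - vert T 1) \<le> est T 0"
    using initial_gap_upper[OF vert_in[OF active_1]] initial_gap_le_est by simp
  have "est T 0 = 0 \<or> \<alpha> = 1"
    using assms initial_gap_nonneg initial_gap_le_est by auto
  then show ?thesis using g pt_1 by (auto simp: lcg_improving_def)
qed

lemma terminates: "lcg_terminates \<phi>' \<alpha> \<eta> T"
proof (cases "est T 0 > 0")
  case True
  then show ?thesis
    using stops_within_potential[OF active_1] by (auto simp: lcg_terminates_def)
next
  case False
  then show ?thesis
    using stops_after_underestimate not_improving_1 \<eta> by (auto simp: lcg_terminates_def)
qed

text \<open>The hypothesis keeps the weight of an estimate below \<eta> out of the bound: either the
  first estimate is at least \<eta>, or \<alpha> = 1 makes the first iteration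
  non-improving.\<close>

lemma calls_le:
  assumes "\<eta> \<le> est T 0 \<or> \<alpha> = 1"
  shows "real (lcg_calls \<phi>' \<alpha> \<eta> T) \<le>
    2 + 2 * \<alpha> + 14 * \<alpha>\<^sup>2 * (\<beta> * D\<^sup>2) / \<eta> + (4 * \<alpha> + 1) * (log 2 (max 1 (initial_gap / \<eta>)) + 1)"
    (is "_ \<le> ?bound")
proof -
  define P where "P = est T 0"
  define B where "B = 2 * \<alpha>\<^sup>2 * (\<beta> * D\<^sup>2)"
  have B: "B \<ge> 0" using curvature_nonneg by (simp add: B_def)
  define l where "l = (4 * \<alpha> + 1) * (log 2 (max 1 (initial_gap / \<eta>)) + 1)"
  have l: "l \<ge> 0" using \<alpha> by (auto simp: l_def intro!: mult_nonneg_nonneg)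
  \<comment> \<open>Of the 7 multiples of \<open>B / \<eta>\<close>, one comes from the weighted
    initial gap and six from \<open>later_iters\<close>, whose coefficient is \<open>2 * B\<close>
    times at most 3/\<eta>.\<close>
  have bound: "?bound = 2 + 2 * \<alpha> + 7 * (B / \<eta>) + l"
    by (simp add: B_def l_def)
  have "\<exists>s. lcg_stops_at \<phi>' \<alpha> \<eta> T s \<and> real s \<le> 2 + 2 * \<alpha> + 7 * (B / \<eta>) + l"
  proof (cases "P < \<eta>")
    case True
    then obtain s where "lcg_stops_at \<phi>' \<alpha> \<eta> T s" "real s \<le> 2 + (2 * \<alpha> + B / \<eta>)"
      using stops_after_underestimate not_improving_1 assms by (auto simp: P_def B_def)
    moreover have "0 \<le> B / \<eta>" using B \<eta> by simp
    ultimately show ?thesis using l by (intro exI[of _ s]) auto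
  next
    case False
    then have P: "P \<ge> \<eta>" "P > 0" using \<eta> by auto
    have "\<phi> u1 - inf_\<phi> \<le> P"
      using primal_gap_le[OF u1 initial_gap_upper] initial_gap_le_est by (simp add: P_def)
    then have "(\<phi> u1 - inf_\<phi>) * weight P \<le> P * weight P"
      using weight_pos[OF P(2)] by (intro mult_right_mono) auto
    also have "\<dots> = 2 * \<alpha> + B / P" using scaled_weight[OF P(2)] by (simp add: B_def)
    also have "\<dots> \<le> 2 * \<alpha> + B / \<eta>" using P \<eta> B by (intro add_left_mono divide_left_mono) auto
    finally have w: "(\<phi> u1 - inf_\<phi>) * weight P \<le> 2 * \<alpha> + B / \<eta>" .
    have "later_iters P \<le> l + 6 * (B / \<eta>)"
    proof (cases "P = \<eta>")
      case True
      then show ?thesis using l B \<eta> by (simp add: later_iters_def)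
    next
      case False
      have "P / \<eta> \<le> max 1 (initial_gap / \<eta>)"
        using est_0_le \<eta> by (auto simp: P_def max_def field_simps split: if_splits)
      then have "(4 * \<alpha> + 1) * (log 2 (P / \<eta>) + 1) \<le> l"
        unfolding l_def using \<alpha> P \<eta> by (intro mult_left_mono add_right_mono) auto
      moreover have "2 * B * (3 / \<eta> - 2 / P) \<le> 2 * B * (3 / \<eta>)"
        using B P by (intro mult_left_mono) auto
      ultimately show ?thesis using False P by (simp add: later_iters_def B_def)
    qed
    with w have "potential 1 \<le> 2 * \<alpha> + 7 * (B / \<eta>) + l"
      using pt_1 by (simp add: potential_def P_def[symmetric])
    moreover obtain s where "lcg_stops_at \<phi>' \<alpha> \<eta> T s" "real s \<le> 1 + potential 1"
      using stops_within_potential[OF active_1] P by (auto simp: P_def)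
    ultimately show ?thesis by (intro exI[of _ s]) auto
  qed
  then obtain s where s: "lcg_stops_at \<phi>' \<alpha> \<eta> T s" "real s \<le> ?bound" using bound by auto
  have "lcg_calls \<phi>' \<alpha> \<eta> T \<le> s" unfolding lcg_calls_def using s(1) by (rule Least_le)
  with s(2) show ?thesis by linarith
qed

text \<open>The stopping iteration is itself reached and non-improving with estimate \<eta>, so the
  oracle certificate holds at the returned point.\<close>

lemma
  shows output_in: "lcg_output \<phi>' \<alpha> \<eta> T \<in> X"
    and output_gap: "w \<in> X \<Longrightarrow> inner (\<phi>' (lcg_output \<phi>' \<alpha> \<eta> T)) (lcg_output \<phi>' \<alpha> \<eta> T - w) \<le> \<eta>"
proof -
  let ?t = "lcg_calls \<phi>' \<alpha> \<eta> T"
  have stop: "lcg_stops_at \<phi>' \<alpha> \<eta> T ?t"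
    using terminates unfolding lcg_terminates_def lcg_calls_def by (rule LeastI_ex)
  have act: "active ?t"
    using stop not_less_Least[of _ "lcg_stops_at \<phi>' \<alpha> \<eta> T"]
    by (auto simp: active_def lcg_calls_def lcg_stops_at_def)
  show "lcg_output \<phi>' \<alpha> \<eta> T \<in> X"
    unfolding lcg_output_def by (rule pt_in[OF act])
  show "inner (\<phi>' (lcg_output \<phi>' \<alpha> \<eta> T)) (lcg_output \<phi>' \<alpha> \<eta> T - w) \<le> \<eta>" if "w \<in> X"
    using not_improving_gap_le[OF act _ that] stop by (simp add: lcg_output_def lcg_stops_at_def)
qed

end


section \<open>CALGD\<close>

text \<open>A quadratic equals its second-order expansion; this yields both models of
  \<open>\<phi>\<close> demanded by \<open>lcg_execution\<close>, with curvature \<beta>.\<close>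

lemma prox_obj_expand:
  "prox_obj g \<beta> x w = prox_obj g \<beta> x u + inner (prox_grad g \<beta> x u) (w - u)
     + \<beta> / 2 * (norm (w - u))\<^sup>2"
  unfolding prox_obj_def prox_grad_def power2_norm_eq_inner
  by (simp add: inner_diff_left inner_diff_right inner_add_left inner_commute algebra_simps)

locale calgd_execution =
  fixes n :: nat and X :: "fseq set" and f :: "fseq \<Rightarrow> real" and f' :: "fseq \<Rightarrow> fseq"
    and L :: real and x0 :: fseq and start :: "real \<Rightarrow> real \<Rightarrow> real" and \<alpha> :: real
    and N :: nat and R :: "fseq calgd_trace"
  assumes problem: "smooth_convex_problem n X f f' L"
    and x0: "x0 \<in> X" and start: "start \<in> {exact_start, clipped_start}" and \<alpha>: "\<alpha> \<ge> 1"
    and run: "calgd_run X f' start \<alpha> (beta_seq L) gamma_seq (eta_seq L (diameter X)) x0 N R"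
begin

abbreviation "D \<equiv> diameter X"
abbreviation "\<eta> \<equiv> eta_seq L D"
abbreviation "sub_grad k \<equiv> sub_grad_at f' (beta_seq L) R k"

lemma L_pos: "L > 0" and convex_X: "convex X" and convex_f: "convex_on X f"
  and has_gradient: "x \<in> X \<Longrightarrow> (f has_derivative (\<lambda>h. inner (f' x) h)) (at x within X)"
  using problem by (auto simp: smooth_convex_problem_def)

lemma diam: "x \<in> X \<Longrightarrow> y \<in> X \<Longrightarrow> norm (x - y) \<le> D"
  using problem by (intro diameter_norm_le compact_imp_bounded) (auto simp: smooth_convex_problem_def)

lemma D_nonneg: "D \<ge> 0"
  using diam[OF x0 x0] by simp

lemma gradient_lipschitz:
  assumes "x \<in> X" "y \<in> X"
  shows "norm (f' x - f' y) \<le> L * norm (x - y)"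
proof -
  have "norm (f' x - f' y) \<le> conj_norm (Rspace n) (f' x - f' y)"
    using assms problem
    by (intro norm_le_conj_norm subspace_Rspace subspace_diff) (auto simp: smooth_convex_problem_def)
  also have "\<dots> \<le> L * norm (x - y)"
    using assms problem by (auto simp: smooth_convex_problem_def)
  finally show ?thesis .
qed

section \<open>The subproblems inside a run\<close>

lemma step:
  assumes "k \<in> {1..N}"
  shows zs: "zs R k = (1 - gamma_seq k) *\<^sub>R ys R (k - 1) + gamma_seq k *\<^sub>R xs R (k - 1)"
    and lcg_run: "lcg_run X start (prox_obj (f' (zs R k)) (beta_seq L k) (xs R (k - 1)))
                    (sub_grad k) \<alpha> (\<eta> k) (xs R (k - 1)) (lcg R k)"
    and xs: "xs R k = lcg_output (sub_grad k) \<alpha> (\<eta> k) (lcg R k)"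
    and ys: "ys R k = (1 - gamma_seq k) *\<^sub>R ys R (k - 1) + gamma_seq k *\<^sub>R xs R k"
  using run assms unfolding calgd_run_def by blast+

lemma lcg_execution:
  assumes "D > 0" "k \<in> {1..N}" "xs R (k - 1) \<in> X"
  shows "lcg_execution X start (prox_obj (f' (zs R k)) (beta_seq L k) (xs R (k - 1)))
    (sub_grad k) \<alpha> (\<eta> k) (xs R (k - 1)) (lcg R k) (beta_seq L k) D"
proof
  have \<beta>: "0 \<le> beta_seq L k" using L_pos by (simp add: beta_seq_def)
  show "0 \<le> beta_seq L k" by fact
  show "0 < \<eta> k" using assms L_pos by (simp add: eta_seq_def)
  fix u w
  show "prox_obj (f' (zs R k)) (beta_seq L k) (xs R (k - 1)) u + inner (sub_grad k u) (w - u)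
      \<le> prox_obj (f' (zs R k)) (beta_seq L k) (xs R (k - 1)) w"
    unfolding sub_grad_at_def using \<beta> by (subst prox_obj_expand[where w = w and u = u]) simp
  show "prox_obj (f' (zs R k)) (beta_seq L k) (xs R (k - 1)) w
      \<le> prox_obj (f' (zs R k)) (beta_seq L k) (xs R (k - 1)) u + inner (sub_grad k u) (w - u)
        + beta_seq L k / 2 * (norm (w - u))\<^sup>2"
    unfolding sub_grad_at_def by (subst prox_obj_expand[where w = w and u = u]) simp
qed (use assms lcg_run start \<alpha> convex_X diam in auto)

text \<open>Here \<open>X\<close> is a single point, so under both start rules the first estimate
  equals \<open>\<eta> k = 0\<close>, and the answer has gap 0.\<close>

lemma lcg_stops_at_1:
  assumes "D = 0" "k \<in> {1..N}" "xs R (k - 1) \<in> X"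
  shows "lcg_stops_at (sub_grad k) \<alpha> (\<eta> k) (lcg R k) 1"
proof -
  have single: "w = xs R (k - 1)" if "w \<in> X" for w
    using diam[OF that assms(3)] \<open>D = 0\<close> by simp
  have "X = {xs R (k - 1)}" using single assms(3) by blast
  then have "(SUP w\<in>X. inner (sub_grad k (xs R (k - 1))) (xs R (k - 1) - w)) = 0"
    by simp
  moreover have \<eta>: "\<eta> k = 0" using \<open>D = 0\<close> by (simp add: eta_seq_def)
  ultimately have est: "est (lcg R k) 0 = 0"
    using lcg_run[OF assms(2)] start
    by (auto simp: lcg_run_def exact_start_def clipped_start_def)
  have pt: "pt (lcg R k) 1 = xs R (k - 1)"
    using lcg_run[OF assms(2)] by (simp add: lcg_run_def)
  have "LOsep X (sub_grad k (pt (lcg R k) 1)) (pt (lcg R k) 1) (est (lcg R k) (1 - 1)) \<alpha> (vert (lcg R k) 1)"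
    using lcg_run[OF assms(2)] unfolding lcg_run_def
    by (metis le_refl lcg_stops_at_def not_le)
  then have "vert (lcg R k) 1 \<in> X" by (simp add: LOsep_def extreme_point_of_def)
  then have "vert (lcg R k) 1 = xs R (k - 1)" by (rule single)
  then show ?thesis
    using pt est \<eta> by (simp add: lcg_stops_at_def lcg_improving_def)
qed

text \<open>Feasibility of the previous point is a premise so that \<open>iterates_in\<close> can
  apply this inside its induction.\<close>

lemma subproblem:
  assumes "k \<in> {1..N}" "xs R (k - 1) \<in> X"
  shows "lcg_terminates (sub_grad k) \<alpha> (\<eta> k) (lcg R k) \<and> xs R k \<in> X \<and>
    (\<forall>w\<in>X. inner (sub_grad k (xs R k)) (xs R k - w) \<le> \<eta> k)"
proof (cases "D = 0")
  case False
  then interpret lcg_execution X start "prox_obj (f' (zs R k)) (beta_seq L k) (xs R (k - 1))"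
    "sub_grad k" \<alpha> "\<eta> k" "xs R (k - 1)" "lcg R k" "beta_seq L k" D
    using lcg_execution assms D_nonneg by simp
  show ?thesis using terminates output_in output_gap xs[OF assms(1)] by simp
next
  case True
  note stop = lcg_stops_at_1[OF True assms]
  have "lcg_calls (sub_grad k) \<alpha> (\<eta> k) (lcg R k) = 1"
    unfolding lcg_calls_def using stop by (intro Least_equality) (auto simp: lcg_stops_at_def)
  then have eq: "xs R k = xs R (k - 1)"
    using xs[OF assms(1)] lcg_run[OF assms(1)] by (simp add: lcg_output_def lcg_run_def)
  have "inner (sub_grad k (xs R k)) (xs R k - w) \<le> \<eta> k" if "w \<in> X" for w
    using diam[OF that assms(2)] True eq by (simp add: eta_seq_def)
  then show ?thesis
    using stop assms(2) eq by (auto simp: lcg_terminates_def)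
qed

section \<open>Convergence rate of the outer iterations\<close>

lemma gamma_seq_bounds: "k \<ge> 1 \<Longrightarrow> 0 \<le> gamma_seq k \<and> gamma_seq k \<le> 1"
  by (simp add: gamma_seq_def)

lemma iterates_in: "k \<le> N \<Longrightarrow> xs R k \<in> X \<and> ys R k \<in> X"
proof (induction k)
  case 0
  then show ?case using run x0 by (simp add: calgd_run_def)
next
  case (Suc k)
  then have k: "Suc k \<in> {1..N}" and IH: "xs R k \<in> X" "ys R k \<in> X" by auto
  have x: "xs R (Suc k) \<in> X" using subproblem[OF k] IH by simp
  have "ys R (Suc k) \<in> X"
    unfolding ys[OF k] using gamma_seq_bounds[of "Suc k"] x IH convex_X by (intro convexD) auto
  with x show ?case by simp
qed

lemma zs_in:
  assumes "k \<in> {1..N}"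
  shows "zs R k \<in> X"
  unfolding zs[OF assms] using gamma_seq_bounds[of k] iterates_in[of "k - 1"] assms convex_X
  by (intro convexD) auto

lemma gap_step:
  assumes k: "k \<in> {1..N}" and x: "x \<in> X"
  shows "f (ys R k) - f x \<le> (1 - gamma_seq k) * (f (ys R (k - 1)) - f x) + gamma_seq k * \<eta> k
    + gamma_seq k * beta_seq L k / 2 * ((norm (xs R (k - 1) - x))\<^sup>2 - (norm (xs R k - x))\<^sup>2)"
proof -
  define g b z xk xp yp where "g = gamma_seq k" "b = beta_seq L k" "z = zs R k"
    "xk = xs R k" "xp = xs R (k - 1)" "yp = ys R (k - 1)"
  note defs = this
  have g: "0 \<le> g" "g \<le> 1" using gamma_seq_bounds[of k] k by (auto simp: defs)
  have X: "z \<in> X" "xk \<in> X" "xp \<in> X" "yp \<in> X" "ys R k \<in> X"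
    using k zs_in iterates_in by (auto simp: defs)
  have zeq: "z = (1 - g) *\<^sub>R yp + g *\<^sub>R xp" using zs[OF k] by (simp add: defs)
  have yeq: "ys R k = (1 - g) *\<^sub>R yp + g *\<^sub>R xk" using ys[OF k] by (simp add: defs)
  have yz: "ys R k - z = g *\<^sub>R (xk - xp)" unfolding zeq yeq by (simp add: algebra_simps)
  \<comment> \<open>Pairs the gradient with \<open>yp - z\<close> and \<open>x - z\<close>, where
    convexity applies, and with \<open>xk - x\<close>, where the subproblem certificate
    applies.\<close>
  have yz': "ys R k - z = (1 - g) *\<^sub>R (yp - z) + g *\<^sub>R (xk - x) + g *\<^sub>R (x - z)"
    unfolding yeq by (simp add: algebra_simps)
  have descent: "f (ys R k) \<le> f z + inner (f' z) (ys R k - z) + L / 2 * (norm (ys R k - z))\<^sup>2"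
    by (rule descent_lemma[OF convex_X X(1,5) has_gradient gradient_lipschitz])
  have "f (ys R k) \<le> (1 - g) * (f z + inner (f' z) (yp - z)) + g * (f z + inner (f' z) (x - z))
      + g * inner (f' z) (xk - x) + L * g\<^sup>2 / 2 * (norm (xk - xp))\<^sup>2"
  proof -
    have "inner (f' z) (ys R k - z) =
        (1 - g) * inner (f' z) (yp - z) + g * inner (f' z) (xk - x) + g * inner (f' z) (x - z)"
      unfolding yz' by (simp add: inner_add_right)
    moreover have "(norm (ys R k - z))\<^sup>2 = g\<^sup>2 * (norm (xk - xp))\<^sup>2"
      unfolding yz by (simp add: power_mult_distrib)
    ultimately show ?thesis using descent by (simp add: algebra_simps)
  qed
  also have "(1 - g) * (f z + inner (f' z) (yp - z)) \<le> (1 - g) * f yp"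
    using convex_on_gradient_le[OF convex_f X(1,4) has_gradient] g by (intro mult_left_mono) auto
  also have "g * (f z + inner (f' z) (x - z)) \<le> g * f x"
    using convex_on_gradient_le[OF convex_f X(1) x has_gradient] g by (intro mult_left_mono) auto
  also have "g * inner (f' z) (xk - x) \<le> g * (\<eta> k - b * inner (xk - xp) (xk - x))"
    using subproblem[OF k] X(3) x g
    by (intro mult_left_mono) (auto simp: sub_grad_at_def prox_grad_def defs inner_add_left)
  \<comment> \<open>The three-point identity produces the telescoping distances and a spare negative
    multiple of the squared step.\<close>
  also have "inner (xk - xp) (xk - x) =
      ((norm (xk - xp))\<^sup>2 + (norm (xk - x))\<^sup>2 - (norm (xp - x))\<^sup>2) / 2"
    unfolding power2_norm_eq_inner
    by (simp add: inner_diff_left inner_diff_right inner_commute)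
  \<comment> \<open>That spare term absorbs the descent error, since L \<gamma> \<le>
    \<beta>.\<close>
  also have "L * g\<^sup>2 / 2 * (norm (xk - xp))\<^sup>2 \<le> g * b / 2 * (norm (xk - xp))\<^sup>2"
  proof -
    have "L * g \<le> b" using L_pos by (simp add: defs gamma_seq_def beta_seq_def frac_le)
    then have "g * (L * g) \<le> g * b" using g by (intro mult_left_mono)
    then show ?thesis
      by (intro mult_right_mono) (auto simp: power2_eq_square mult_ac)
  qed
  finally show ?thesis unfolding defs[symmetric] by (simp add: field_simps)
qed

text \<open>With \<open>1 - \<gamma>\<^sub>k = (k - 1) / (k + 2)\<close>, multiplying \<open>gap_step\<close> by \<open>k (k + 1) (k + 2)\<close> makes it
  telescope.\<close>

lemma scaled_gap_le:
  assumes "k \<le> N" and x: "x \<in> X"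
  shows "real k * (real k + 1) * (real k + 2) * (f (ys R k) - f x) \<le>
    3 * real k * L * D\<^sup>2 + 9 * L / 2 * (real k * D\<^sup>2 - real k * (norm (xs R k - x))\<^sup>2)"
  using assms(1)
proof (induction k)
  case 0
  then show ?case by simp
next
  case (Suc j)
  define k where "k = real (Suc j)"
  have k: "k \<ge> 1" "real j = k - 1" by (auto simp: k_def)
  define d d' r r' where "d = f (ys R (Suc j)) - f x" "d' = f (ys R j) - f x"
    "r = (norm (xs R (Suc j) - x))\<^sup>2" "r' = (norm (xs R j - x))\<^sup>2"
  note defs = this
  have IH: "(k - 1) * k * (k + 1) * d' \<le> 3 * (k - 1) * L * D\<^sup>2 + 9 * L / 2 * ((k - 1) * D\<^sup>2 - (k - 1) * r')"
    using Suc by (simp add: defs k algebra_simps)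
  \<comment> \<open>The distances carry the weight \<open>k\<close>, one more than in the hypothesis
    for \<open>j\<close>; the surplus \<open>r'\<close> is paid by one more
    \<open>D^2\<close>.\<close>
  have "r' \<le> D\<^sup>2"
    unfolding defs using iterates_in[of j] Suc.prems x diam by (intro power_mono) auto
  then have r': "9 * L / 2 * r' \<le> 9 * L / 2 * D\<^sup>2" using L_pos by (intro mult_left_mono) auto
  have "d \<le> (1 - 3 / (k + 2)) * d' + 3 / (k + 2) * (L * D\<^sup>2 / (k * (k + 1)))
      + 3 / (k + 2) * (3 * L / (k + 1)) / 2 * (r' - r)"
    using gap_step[of "Suc j" x] Suc.prems x
    unfolding gamma_seq_def beta_seq_def eta_seq_def k_def[symmetric] defs by simp
  then have "k * (k + 1) * (k + 2) * d \<le> k * (k + 1) * (k + 2) * ((1 - 3 / (k + 2)) * d'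
      + 3 / (k + 2) * (L * D\<^sup>2 / (k * (k + 1))) + 3 / (k + 2) * (3 * L / (k + 1)) / 2 * (r' - r))"
    using k by (intro mult_left_mono) auto
  also have "\<dots> = (k - 1) * k * (k + 1) * d' + 3 * L * D\<^sup>2 + 9 * L / 2 * k * (r' - r)"
  proof -
    have "1 - 3 / (k + 2) = (k - 1) / (k + 2)" using k by (simp add: field_simps)
    moreover have "k + 2 \<noteq> 0" "k + 1 \<noteq> 0" "k \<noteq> 0" using k by auto
    ultimately show ?thesis by (simp add: divide_simps) (simp add: algebra_simps)
  qed
  also have "\<dots> \<le> 3 * k * L * D\<^sup>2 + 9 * L / 2 * (k * D\<^sup>2 - k * r)"
  proof -
    define e P where "e = 9 * L / 2" "P = (k - 1) * k * (k + 1) * d'"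
    show ?thesis using IH r' unfolding e_P_def[symmetric] by (simp add: algebra_simps)
  qed
  finally show ?case by (simp add: defs k_def)
qed

text \<open>Dropping the distance term in \<open>scaled_gap_le\<close> leaves k (3 + 9/2) L D^2;
  cancelling k gives the constant 15/2.\<close>

lemma convergence:
  assumes "k \<in> {1..N}" "x \<in> X"
  shows "f (ys R k) - f x \<le> conv_bound L D k"
proof -
  define q d where "q = real k" "d = f (ys R k) - f x"
  have q: "q \<ge> 1" using assms by (simp add: q_d_def)
  have "0 \<le> 9 * L / 2 * (q * (norm (xs R k - x))\<^sup>2)" using L_pos q by simp
  then have "q * (q + 1) * (q + 2) * d \<le> q * (15 / 2 * L * D\<^sup>2)"
    using scaled_gap_le[of k x] assms by (simp add: q_d_def[symmetric] algebra_simps)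
  then have "q * ((q + 1) * (q + 2) * d) \<le> q * (15 / 2 * L * D\<^sup>2)" by (simp add: mult_ac)
  then have "(q + 1) * (q + 2) * d \<le> 15 / 2 * L * D\<^sup>2" using q by simp
  then have "d * (2 * (q + 1) * (q + 2)) \<le> 15 * L * D\<^sup>2" by (simp add: algebra_simps)
  moreover have "2 * (q + 1) * (q + 2) > 0" using q by simp
  ultimately have "d \<le> 15 * L * D\<^sup>2 / (2 * (q + 1) * (q + 2))"
    by (simp only: pos_le_divide_eq)
  then show ?thesis by (simp add: conv_bound_def q_d_def)
qed

section \<open>Number of separation oracle calls\<close>

definition "gradient_ratio = (norm (f' x0) + L * D) / (L * D)"

text \<open>The curvature ratio \<beta> D^2 / \<eta> is exactly 3 k, and the initial gap is at most
  \<open>gradient_ratio\<close> times k (k + 1) \<eta>, so its logarithm adds a linear term and a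
  constant.\<close>

lemma lcg_calls_le:
  assumes D: "D > 0" and k: "k \<in> {1..N}" and est: "\<alpha> = 1 \<or> start = clipped_start \<or> \<eta> k \<le> est (lcg R k) 0"
  shows "real (lcg_calls (sub_grad k) \<alpha> (\<eta> k) (lcg R k)) \<le>
    (5 + 14 * \<alpha> + 42 * \<alpha>\<^sup>2) * real k + (4 * \<alpha> + 1) * log 2 gradient_ratio"
proof -
  have xp: "xs R (k - 1) \<in> X" using iterates_in[of "k - 1"] k by auto
  interpret lcg_execution X start "prox_obj (f' (zs R k)) (beta_seq L k) (xs R (k - 1))"
    "sub_grad k" \<alpha> "\<eta> k" "xs R (k - 1)" "lcg R k" "beta_seq L k" D
    by (rule lcg_execution[OF D k xp])
  define q A where "q = real k" "A = gradient_ratio"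
  note defs = this
  define G where "G = max 1 (initial_gap / \<eta> k)"
  have q: "q \<ge> 1" using k by (simp add: defs)
  have A: "A \<ge> 1" using D L_pos by (simp add: defs gradient_ratio_def field_simps)
  have curv: "beta_seq L k * D\<^sup>2 / \<eta> k = 3 * q"
  proof -
    have "q + 1 \<noteq> 0" "L * D\<^sup>2 \<noteq> 0" using q D L_pos by auto
    then show ?thesis unfolding beta_seq_def eta_seq_def defs(1)[symmetric] by simp
  qed
  \<comment> \<open>Lipschitz continuity from \<open>x0\<close> bounds all gradients that occur;
    \<open>gradient_ratio\<close> is this bound in units of L D.\<close>
  have "norm (f' (zs R k)) \<le> norm (f' x0) + norm (f' (zs R k) - f' x0)"
    by (metis add.commute diff_add_cancel norm_triangle_ineq)
  also have "norm (f' (zs R k) - f' x0) \<le> L * norm (zs R k - x0)"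
    by (intro gradient_lipschitz zs_in k x0)
  also have "\<dots> \<le> L * D" using L_pos by (intro mult_left_mono diam zs_in k x0) auto
  finally have g: "norm (f' (zs R k)) \<le> A * (L * D)"
    using D L_pos by (simp add: defs gradient_ratio_def)
  \<comment> \<open>At the starting point \<open>xs R (k - 1)\<close> the proximal part of the
    gradient vanishes.\<close>
  have "initial_gap \<le> norm (f' (zs R k)) * D"
    using initial_gap_le by (simp add: sub_grad_at_def prox_grad_def)
  also have "\<dots> \<le> A * (L * D) * D" using g D by (intro mult_right_mono) auto
  also have "\<dots> = A * (q * (q + 1)) * \<eta> k"
    using q by (simp add: eta_seq_def defs[symmetric] power2_eq_square)
  finally have "initial_gap / \<eta> k \<le> A * (q * (q + 1))"
    using \<eta> by (simp add: pos_divide_le_eq)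
  moreover have "1 * 1 \<le> A * (q * (q + 1))"
    using A q mult_mono[of 1 q 1 "q + 1"] by (intro mult_mono) auto
  ultimately have "G \<le> A * (q * (q + 1))" "G > 0" by (simp_all add: G_def)
  then have "log 2 G \<le> log 2 (A * (q * (q + 1)))" by simp
  also have "\<dots> = log 2 A + log 2 (q * (q + 1))" using A q by (intro log_mult_pos) auto
  \<comment> \<open>The crude bound k + 1 \<le> 2^k is enough, as the curvature term is linear in k
    anyway.\<close>
  also have "log 2 (q * (q + 1)) \<le> 2 * q"
  proof -
    have "Suc k \<le> 2 ^ k" using less_exp[of k] by (rule Suc_leI)
    then have "k * (k + 1) \<le> 2 ^ k * 2 ^ k" by (intro mult_mono) auto
    then have "k * (k + 1) \<le> 2 ^ (2 * k)" by (simp add: mult_2 power_add)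
    then have "log 2 (real (k * (k + 1))) \<le> real (2 * k)"
      using k by (intro log2_of_power_le) auto
    moreover have "real (k * (k + 1)) = q * (q + 1)" "real (2 * k) = 2 * q"
      unfolding defs by (simp_all only: of_nat_mult of_nat_add of_nat_1 of_nat_numeral)
    ultimately show ?thesis by simp
  qed
  finally have "(4 * \<alpha> + 1) * (log 2 G + 1) \<le> (4 * \<alpha> + 1) * (log 2 A + 2 * q + 1)"
    using \<alpha> by (intro mult_left_mono) auto
  also have "\<dots> = (8 * \<alpha> + 2) * q + (4 * \<alpha> + 1) + (4 * \<alpha> + 1) * log 2 A"
    by (simp add: algebra_simps)
  finally have l: "(4 * \<alpha> + 1) * (log 2 G + 1)
      \<le> (8 * \<alpha> + 2) * q + (4 * \<alpha> + 1) + (4 * \<alpha> + 1) * log 2 A" .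
  have "\<eta> k \<le> est (lcg R k) 0 \<or> \<alpha> = 1"
    using est est_0 by (auto simp: clipped_start_def)
  then have "real (lcg_calls (sub_grad k) \<alpha> (\<eta> k) (lcg R k)) \<le> 2 + 2 * \<alpha>
      + 14 * \<alpha>\<^sup>2 * (beta_seq L k * D\<^sup>2) / \<eta> k + (4 * \<alpha> + 1) * (log 2 G + 1)"
    unfolding G_def by (rule calls_le)
  also have "14 * \<alpha>\<^sup>2 * (beta_seq L k * D\<^sup>2) / \<eta> k = 14 * \<alpha>\<^sup>2 * (3 * q)"
    unfolding curv[symmetric] by (rule times_divide_eq_right[symmetric])
  finally have "real (lcg_calls (sub_grad k) \<alpha> (\<eta> k) (lcg R k)) \<le> 2 + 2 * \<alpha>
      + 14 * \<alpha>\<^sup>2 * (3 * q) + (4 * \<alpha> + 1) * (log 2 G + 1)" .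
  also have "\<dots> \<le> 2 + 2 * \<alpha> + 14 * \<alpha>\<^sup>2 * (3 * q)
      + ((8 * \<alpha> + 2) * q + (4 * \<alpha> + 1) + (4 * \<alpha> + 1) * log 2 A)"
    by (intro add_left_mono l)
  also have "\<dots> = (3 + 6 * \<alpha>) * 1 + (2 + 8 * \<alpha> + 42 * \<alpha>\<^sup>2) * q + (4 * \<alpha> + 1) * log 2 A"
    by (simp add: algebra_simps)
  also have "\<dots> \<le> (3 + 6 * \<alpha>) * q + (2 + 8 * \<alpha> + 42 * \<alpha>\<^sup>2) * q + (4 * \<alpha> + 1) * log 2 A"
    using \<alpha> q by (intro add_right_mono mult_left_mono) auto
  also have "\<dots> = (5 + 14 * \<alpha> + 42 * \<alpha>\<^sup>2) * q + (4 * \<alpha> + 1) * log 2 A"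
    by (simp add: algebra_simps)
  finally have "real (lcg_calls (sub_grad k) \<alpha> (\<eta> k) (lcg R k)) \<le>
    (5 + 14 * \<alpha> + 42 * \<alpha>\<^sup>2) * q + (4 * \<alpha> + 1) * log 2 A" .
  then show ?thesis by (simp only: defs)
qed

text \<open>Replacing k by N in every summand costs at most a factor 2 in the quadratic
  term.\<close>

lemma LO_calls_le:
  assumes D: "D > 0"
    and est: "start = clipped_start \<or> \<alpha> = 1 \<or> (\<forall>k\<in>{1..N}. \<eta> k \<le> est (lcg R k) 0)"
  shows "real (LO_calls f' \<alpha> (beta_seq L) \<eta> N R) \<le>
    (5 + 14 * \<alpha> + 42 * \<alpha>\<^sup>2) * (real N)\<^sup>2 + (4 * \<alpha> + 1) * (real N * log 2 gradient_ratio)"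
proof -
  have "real (LO_calls f' \<alpha> (beta_seq L) \<eta> N R) =
      (\<Sum>k=1..N. real (lcg_calls (sub_grad k) \<alpha> (\<eta> k) (lcg R k)))"
    by (simp add: LO_calls_def)
  also have "\<dots> \<le> (\<Sum>k=1..N. (5 + 14 * \<alpha> + 42 * \<alpha>\<^sup>2) * real N + (4 * \<alpha> + 1) * log 2 gradient_ratio)"
  proof (intro sum_mono)
    fix k assume k: "k \<in> {1..N}"
    have "(5 + 14 * \<alpha> + 42 * \<alpha>\<^sup>2) * real k \<le> (5 + 14 * \<alpha> + 42 * \<alpha>\<^sup>2) * real N"
      using k \<alpha> by (intro mult_left_mono add_nonneg_nonneg) auto
    moreover have "\<alpha> = 1 \<or> start = clipped_start \<or> \<eta> k \<le> est (lcg R k) 0" using est k by auto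
    ultimately show "real (lcg_calls (sub_grad k) \<alpha> (\<eta> k) (lcg R k)) \<le>
        (5 + 14 * \<alpha> + 42 * \<alpha>\<^sup>2) * real N + (4 * \<alpha> + 1) * log 2 gradient_ratio"
      using lcg_calls_le[OF D k] by fastforce
  qed
  also have "\<dots> = (5 + 14 * \<alpha> + 42 * \<alpha>\<^sup>2) * (real N)\<^sup>2 + (4 * \<alpha> + 1) * (real N * log 2 gradient_ratio)"
    by (simp add: power2_eq_square algebra_simps)
  finally show ?thesis .
qed

end

section \<open>Number of outer iterations and total complexity\<close>

lemma outer_iters_bounds:
  assumes "L * D\<^sup>2 > 0" "0 < \<epsilon>" "\<epsilon> \<le> L * D\<^sup>2"
  shows "outer_iters L D \<epsilon> \<ge> 1"
    and "conv_bound L D (outer_iters L D \<epsilon>) \<le> \<epsilon>"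
    and "real (outer_iters L D \<epsilon>) \<le> 3 * sqrt (L * D\<^sup>2 / \<epsilon>)"
proof -
  define c where "c = L * D\<^sup>2"
  have c: "c > 0" "\<epsilon> \<le> c" using assms by (auto simp: c_def)
  have cb: "conv_bound L D k \<le> \<epsilon> \<longleftrightarrow> 15 / 2 * (c / \<epsilon>) \<le> (real k + 1) * (real k + 2)" for k
    using \<open>0 < \<epsilon>\<close> by (simp add: conv_bound_def c_def divide_simps) (simp add: algebra_simps)
  define S where "S = c / \<epsilon>"
  have S: "S \<ge> 1" using c \<open>0 < \<epsilon>\<close> by (simp add: S_def)
  let ?P = "\<lambda>k. k \<ge> 1 \<and> conv_bound L D k \<le> \<epsilon>"
  obtain k :: nat where k: "15 / 2 * S < real k" using reals_Archimedean2 by blast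
  have "real k * 1 \<le> (real k + 1) * (real k + 2)" by (intro mult_mono) auto
  moreover have "k \<ge> 1" using k S by (cases k) auto
  ultimately have "?P k" using k unfolding cb S_def[symmetric] by auto
  then have P: "?P (outer_iters L D \<epsilon>)" unfolding outer_iters_def by (rule LeastI)
  then show "outer_iters L D \<epsilon> \<ge> 1" "conv_bound L D (outer_iters L D \<epsilon>) \<le> \<epsilon>" by auto
  show "real (outer_iters L D \<epsilon>) \<le> 3 * sqrt (L * D\<^sup>2 / \<epsilon>)"
  \<comment> \<open>For the value 1 the predecessor 0 is outside the range of the minimum, so only S
    \<ge> 1 is used. Otherwise the predecessor violates the accuracy bound, and 15/2 \<le>
    3^2.\<close>
  proof (cases "outer_iters L D \<epsilon> = 1")
    case True
    have "1 \<le> sqrt S" using S by simp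
    then have "real 1 \<le> 3 * sqrt S" by linarith
    then show ?thesis unfolding True S_def c_def .
  next
    case False
    define m where "m = outer_iters L D \<epsilon> - 1"
    have m: "outer_iters L D \<epsilon> = Suc m" "m \<ge> 1" using P False by (auto simp: m_def)
    have "\<not> ?P m" using m(1) not_less_Least[of m ?P] unfolding outer_iters_def by simp
    then have "(real m + 1) * (real m + 2) < 15 / 2 * S" using m(2) unfolding cb S_def by simp
    moreover have "(real m + 1)\<^sup>2 \<le> (real m + 1) * (real m + 2)"
      unfolding power2_eq_square by (intro mult_left_mono) auto
    ultimately have "(real m + 1)\<^sup>2 \<le> 3\<^sup>2 * S" using S by simp
    then have "real m + 1 \<le> sqrt (3\<^sup>2 * S)" by (rule real_le_rsqrt)
    also have "\<dots> = 3 * sqrt S" by (simp add: real_sqrt_mult)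
    finally show ?thesis unfolding m(1) S_def c_def by simp
  qed
qed

text \<open>The constants are chosen before the dimension and all problem data, so they depend on
  \<alpha> alone. The complexity part asks for \<open>D > 0\<close> because for \<open>D = 0\<close>
  its right-hand sides vanish while one oracle call is still made.\<close>

theorem corollary7:
  fixes \<alpha> :: real
  assumes "\<alpha> \<ge> 1"
  shows "\<exists>C_FO C_LO :: real. \<forall>n X f f' L x0 start.
    smooth_convex_problem n X f f' L \<and>
    (\<exists>B. \<forall>x. minimizer X f x \<longrightarrow> norm (f' x) \<le> B) \<and>
    x0 \<in> X \<and>
    start \<in> {exact_start, clipped_start}
    \<longrightarrow>
    (let D = diameter X; \<beta> = beta_seq L; \<gamma> = gamma_seq; \<eta> = eta_seq L D in
      (\<forall>N R. calgd_run X f' start \<alpha> \<beta> \<gamma> \<eta> x0 N R \<longrightarrow>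
        (\<forall>k\<in>{1..N}.
          lcg_terminates (sub_grad_at f' \<beta> R k) \<alpha> (\<eta> k) (lcg R k) \<and>
          (\<forall>x. minimizer X f x \<longrightarrow>
            f (ys R k) - f x \<le> 15 * L * D\<^sup>2 / (2 * (real k + 1) * (real k + 2))))) \<and>
      (D > 0 \<longrightarrow>
        (\<exists>\<epsilon>0>0. \<forall>\<epsilon>. 0 < \<epsilon> \<and> \<epsilon> < \<epsilon>0 \<longrightarrow>
          (let N = outer_iters L D \<epsilon> in
            \<forall>R. calgd_run X f' start \<alpha> \<beta> \<gamma> \<eta> x0 N R \<longrightarrow>
              eps_solution X f \<epsilon> (ys R N) \<and>
              real (FO_calls N) \<le> C_FO * sqrt (L * D\<^sup>2 / \<epsilon>) \<and>
              (start = clipped_start \<or> \<alpha> = 1 \<or> (\<forall>k\<in>{1..N}. \<eta> k \<le> est (lcg R k) 0) \<longrightarrow>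
                real (LO_calls f' \<alpha> \<beta> \<eta> N R) \<le> C_LO * (L * D\<^sup>2 / \<epsilon>))))))"
proof -
  \<comment> \<open>With S = L D^2 / \<epsilon>, the factors 9 and 3 come from N^2 \<le> 9 S and N *
    log 2 gradient_ratio \<le> 3 S.\<close>
  define C where "C = 9 * (5 + 14 * \<alpha> + 42 * \<alpha>\<^sup>2) + 3 * (4 * \<alpha> + 1)"
  have convergence: "lcg_terminates (sub_grad_at f' (beta_seq L) R k) \<alpha> (eta_seq L (diameter X) k) (lcg R k) \<and>
      (\<forall>x. minimizer X f x \<longrightarrow> f (ys R k) - f x
        \<le> 15 * L * (diameter X)\<^sup>2 / (2 * (real k + 1) * (real k + 2)))"
    if "calgd_execution n X f f' L x0 start \<alpha> N R" "k \<in> {1..N}" for n X f f' L x0 start N R k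
  proof -
    interpret calgd_execution n X f f' L x0 start \<alpha> N R by fact
    show ?thesis
      using subproblem[OF that(2)] iterates_in[of "k - 1"] convergence[OF that(2)] that(2)
      by (auto simp: minimizer_def is_arg_min_def conv_bound_def)
  qed
  have complexity: "eps_solution X f \<epsilon> (ys R N) \<and>
      real (FO_calls N) \<le> 3 * sqrt (L * (diameter X)\<^sup>2 / \<epsilon>) \<and>
      (start = clipped_start \<or> \<alpha> = 1 \<or> (\<forall>k\<in>{1..N}. eta_seq L (diameter X) k \<le> est (lcg R k) 0) \<longrightarrow>
        real (LO_calls f' \<alpha> (beta_seq L) (eta_seq L (diameter X)) N R)
          \<le> C * (L * (diameter X)\<^sup>2 / \<epsilon>))"
    if exec: "calgd_execution n X f f' L x0 start \<alpha> N R" and D: "diameter X > 0"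
      and N: "N = outer_iters L (diameter X) \<epsilon>" and \<epsilon>: "0 < \<epsilon>"
      and small: "\<epsilon> < L * (diameter X)\<^sup>2 /
        (1 + (log 2 ((norm (f' x0) + L * diameter X) / (L * diameter X)))\<^sup>2)"
    for n X f f' L x0 start N R \<epsilon>
  proof -
    interpret calgd_execution n X f f' L x0 start \<alpha> N R by fact
    define a S where "a = log 2 gradient_ratio" "S = L * D\<^sup>2 / \<epsilon>"
    note defs = this
    have c: "L * D\<^sup>2 > 0" using D L_pos by simp
    have "1 + a\<^sup>2 > 0" by (intro add_pos_nonneg) auto
    \<comment> \<open>The threshold on \<epsilon> is made for this: \<open>a^2 \<le> S\<close> turns
      \<open>N * a\<close> into O(S), and the summand 1 gives \<open>S \<ge> 1\<close>.\<close>
    then have aS: "1 + a\<^sup>2 \<le> S"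
      using small \<epsilon> by (simp add: defs gradient_ratio_def field_simps)
    then have a: "a \<le> sqrt S" by (intro real_le_rsqrt) simp
    have S: "S \<ge> 1" using aS zero_le_power2[of a] by linarith
    then have "\<epsilon> \<le> L * D\<^sup>2" using \<epsilon> by (simp add: defs)
    note oi = outer_iters_bounds[OF c \<epsilon> this, folded N defs]
    have NN: "N \<in> {1..N}" using oi(1) by simp
    have "eps_solution X f \<epsilon> (ys R N)"
      using convergence[OF NN] oi(2) iterates_in[of N]
      by (fastforce simp: eps_solution_def minimizer_def is_arg_min_def)
    moreover have "real (FO_calls N) \<le> 3 * sqrt S" using oi(3) by (simp add: FO_calls_def)
    moreover have "real (LO_calls f' \<alpha> (beta_seq L) \<eta> N R) \<le> C * S"
      if "start = clipped_start \<or> \<alpha> = 1 \<or> (\<forall>k\<in>{1..N}. \<eta> k \<le> est (lcg R k) 0)"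
    proof -
      have "(real N)\<^sup>2 \<le> (3 * sqrt S)\<^sup>2" using oi(3) by (intro power_mono) auto
      then have N2: "(real N)\<^sup>2 \<le> 9 * S" using S by (simp add: power_mult_distrib)
      have "real N * a \<le> real N * sqrt S" using a by (intro mult_left_mono) auto
      also have "\<dots> \<le> 3 * sqrt S * sqrt S" using oi(3) S by (intro mult_right_mono) auto
      also have "\<dots> = 3 * S" using S by (simp add: mult.assoc)
      finally have Na: "real N * a \<le> 3 * S" .
      have "real (LO_calls f' \<alpha> (beta_seq L) \<eta> N R) \<le>
          (5 + 14 * \<alpha> + 42 * \<alpha>\<^sup>2) * (real N)\<^sup>2 + (4 * \<alpha> + 1) * (real N * a)"
        using LO_calls_le[OF D that] by (simp add: defs)
      also have "\<dots> \<le> (5 + 14 * \<alpha> + 42 * \<alpha>\<^sup>2) * (9 * S) + (4 * \<alpha> + 1) * (3 * S)"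
        using N2 Na assms by (intro add_mono mult_left_mono) auto
      also have "\<dots> = C * S" by (simp add: C_def algebra_simps)
      finally show ?thesis .
    qed
    ultimately show ?thesis by (simp add: defs)
  qed
  have exec: "calgd_execution n X f f' L x0 start \<alpha> N R"
    if "smooth_convex_problem n X f f' L" "x0 \<in> X" "start \<in> {exact_start, clipped_start}"
      "calgd_run X f' start \<alpha> (beta_seq L) gamma_seq (eta_seq L (diameter X)) x0 N R"
    for n X f f' L x0 start N R
    using that assms by unfold_locales
  have threshold: "L * (diameter X)\<^sup>2 / (1 + a\<^sup>2) > 0"
    if "smooth_convex_problem n X f f' L" "diameter X > 0" for n X f f' L and a :: real
    using that by (intro divide_pos_pos add_pos_nonneg) (auto simp: smooth_convex_problem_def)
  show ?thesis
    unfolding Let_def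
  proof (rule exI[of _ 3], rule exI[of _ C], intro allI impI, elim conjE, rule conjI, goal_cases)
    case (1 n X f f' L x0 start)
    show ?case
      by (intro allI impI ballI convergence[OF exec[OF 1(1,3,4)]])
  next
    case (2 n X f f' L x0 start)
    show ?case
    \<comment> \<open>The number \<open>a\<close> in the threshold stays open here; the assumption
      on \<epsilon> below fixes it as the logarithm of the gradient ratio.\<close>
    proof (intro impI, rule exI, rule conjI[OF threshold[OF 2(1)]], assumption, intro allI impI)
      fix \<epsilon> R
      assume D: "0 < diameter X"
        and \<epsilon>: "0 < \<epsilon> \<and> \<epsilon> < L * (diameter X)\<^sup>2 /
          (1 + (log 2 ((norm (f' x0) + L * diameter X) / (L * diameter X)))\<^sup>2)"
        and run: "calgd_run X f' start \<alpha> (beta_seq L) gamma_seq (eta_seq L (diameter X)) x0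
          (outer_iters L (diameter X) \<epsilon>) R"
      from complexity[OF exec[OF 2(1,3,4) run] D refl conjunct1[OF \<epsilon>] conjunct2[OF \<epsilon>]]
      show "eps_solution X f \<epsilon> (ys R (outer_iters L (diameter X) \<epsilon>)) \<and>
        real (FO_calls (outer_iters L (diameter X) \<epsilon>)) \<le> 3 * sqrt (L * (diameter X)\<^sup>2 / \<epsilon>) \<and>
        (start = clipped_start \<or> \<alpha> = 1 \<or>
          (\<forall>k\<in>{1..outer_iters L (diameter X) \<epsilon>}. eta_seq L (diameter X) k \<le> est (lcg R k) 0) \<longrightarrow>
         real (LO_calls f' \<alpha> (beta_seq L) (eta_seq L (diameter X)) (outer_iters L (diameter X) \<epsilon>) R)
           \<le> C * (L * (diameter X)\<^sup>2 / \<epsilon>))" .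
    qed
  qed
qed

end
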